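(* Let $X$ be a two-dimensional real normed space with unit ball $BX$. The following conditions on $X$ are equivalent: (i) $BX$ is a polygon with finitely many sides, and there is a coordinate system in $X$ such that the slopes of all sides of $BX$ are algebraic; (ii) there is a well-distributed set $S\subset X$ such that $$|\Delta_{X,N}(S)|=O(N)\quad(N\to\infty).$$
   Context: $X$ denotes $\mathbb{R}^2$ equipped with a norm $\|\cdot\|_X$, and $BX=\{x:\|x\|_X\le 1\}$. A coordinate system in $X$ is given by two non-collinear vectors $e_1,e_2\in X$, the coordinates $(x_1,x_2)$ of $x\in X$ being determined by $x=x_1e_1+x_2e_2$. For a non-degenerate segment $I\subset X$ contained in the line $u_1x_1+u_2x_2+u_0=0$, its slope (in this coordinate system) is $-u_1/u_2$, or $\infty$ if $u_2=0$; by convention $\infty$ is considered to be an algebraic number. "Algebraic" means algebraic over $\mathbb{Q}$. A set $S\subset X$ is well-distributed if there is a constant $K$ such that for every $x\in X$ there is $y\in S$ with $\|x-y\|_X\le K$. For a positive integer $N$ and $A\subset X$, $\Delta_{X,N}(A)$ is the set of all numbers $\|a-a'\|_X$ with $a,a'\in A$ and $\|a-a'\|_X\le N$; $|\cdot|$ denotes cardinality, and $N$ runs over positive integers. *)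

theory Defs
  imports
    "HOL-Analysis.Analysis"
    "HOL-Computational_Algebra.Polynomial"
    "HOL-Library.Landau_Symbols"
begin

definition is_norm :: "('a::real_vector \<Rightarrow> real) \<Rightarrow> bool" where
  "is_norm nrm \<longleftrightarrow>
     (\<forall>x. nrm x = 0 \<longleftrightarrow> x = 0) \<and>
     (\<forall>c x. nrm (c *\<^sub>R x) = \<bar>c\<bar> * nrm x) \<and>
     (\<forall>x y. nrm (x + y) \<le> nrm x + nrm y)"

definition unit_ball :: "('a \<Rightarrow> real) \<Rightarrow> 'a set" where
  "unit_ball nrm = {x. nrm x \<le> 1}"

(* Only unit balls are considered, so convex polygons suffice; the sides are the
   one-dimensional faces, given by the library relation edge_of. *)
definition convex_polygon :: "'a::euclidean_space set \<Rightarrow> bool" where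
  "convex_polygon P \<longleftrightarrow> polytope P \<and> aff_dim P = 2"

definition coordinate_system :: "'a::real_vector \<Rightarrow> 'a \<Rightarrow> bool" where
  "coordinate_system e1 e2 \<longleftrightarrow> \<not> collinear {0, e1, e2}"

definition coord_line :: "'a::real_vector \<Rightarrow> 'a \<Rightarrow> real \<Rightarrow> real \<Rightarrow> real \<Rightarrow> 'a set" where
  "coord_line e1 e2 u1 u2 u0 =
     {x1 *\<^sub>R e1 + x2 *\<^sub>R e2 | x1 x2. u1 * x1 + u2 * x2 + u0 = 0}"

(* Meaningful for non-degenerate segments I only; see slope_eqI. *)
definition slope :: "'a::real_vector \<Rightarrow> 'a \<Rightarrow> 'a set \<Rightarrow> ereal" where
  "slope e1 e2 I =
     (THE s. \<exists>u1 u2 u0. (u1, u2) \<noteq> (0, 0) \<and> I \<subseteq> coord_line e1 e2 u1 u2 u0 \<and>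
        s = (if u2 = 0 then \<infinity> else ereal (- u1 / u2)))"

(* The value - \<infinity> never occurs as a slope. *)
definition algebraic_slope :: "ereal \<Rightarrow> bool" where
  "algebraic_slope s \<longleftrightarrow> s = \<infinity> \<or> (\<exists>r. s = ereal r \<and> algebraic r)"

definition well_distributed :: "('a::real_vector \<Rightarrow> real) \<Rightarrow> 'a set \<Rightarrow> bool" where
  "well_distributed nrm S \<longleftrightarrow> (\<exists>K. \<forall>x. \<exists>y\<in>S. nrm (x - y) \<le> K)"

definition distance_set :: "('a::real_vector \<Rightarrow> real) \<Rightarrow> nat \<Rightarrow> 'a set \<Rightarrow> real set" where
  "distance_set nrm N A =
     {nrm (a - a') | a a'. a \<in> A \<and> a' \<in> A \<and> nrm (a - a') \<le> real N}"

lemma coordinate_system_unique: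
  assumes "coordinate_system e1 e2" "a *\<^sub>R e1 + b *\<^sub>R e2 = c *\<^sub>R e1 + d *\<^sub>R e2"
  shows "a = c" "b = d"
proof -
  have z: "(a - c) *\<^sub>R e1 = (d - b) *\<^sub>R e2"
    using assms(2) by (simp add: algebra_simps)
  have nz: "e1 \<noteq> 0" "e2 \<noteq> 0" and nc: "\<not> (\<exists>t. e2 = t *\<^sub>R e1)"
    using assms(1) unfolding coordinate_system_def collinear_lemma by auto
  show db: "b = d"
  proof (rule ccontr)
    assume "b \<noteq> d"
    then have "e2 = (1 / (d - b)) *\<^sub>R ((d - b) *\<^sub>R e2)" by simp
    also have "\<dots> = ((a - c) / (d - b)) *\<^sub>R e1" unfolding z[symmetric] by simp
    finally have "e2 = ((a - c) / (d - b)) *\<^sub>R e1" .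
    with nc show False by blast
  qed
  show "a = c" using z db nz by simp
qed

lemma slope_eqI:
  assumes cs: "coordinate_system e1 e2"
    and I: "p \<in> I" "q \<in> I" "p \<noteq> q"
    and u: "(u1, u2) \<noteq> (0, 0)" "I \<subseteq> coord_line e1 e2 u1 u2 u0"
  shows "slope e1 e2 I = (if u2 = 0 then \<infinity> else ereal (- u1 / u2))"
  unfolding slope_def
proof (rule the_equality)
  show "\<exists>v1 v2 v0. (v1, v2) \<noteq> (0, 0) \<and> I \<subseteq> coord_line e1 e2 v1 v2 v0 \<and>
      (if u2 = 0 then \<infinity> else ereal (- u1 / u2)) = (if v2 = 0 then \<infinity> else ereal (- v1 / v2))"
    using u by blast
next
  fix s
  assume "\<exists>v1 v2 v0. (v1, v2) \<noteq> (0, 0) \<and> I \<subseteq> coord_line e1 e2 v1 v2 v0 \<and>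
      s = (if v2 = 0 then \<infinity> else ereal (- v1 / v2))"
  then obtain v1 v2 v0 where v: "(v1, v2) \<noteq> (0, 0)" "I \<subseteq> coord_line e1 e2 v1 v2 v0"
    and s: "s = (if v2 = 0 then \<infinity> else ereal (- v1 / v2))" by blast
  obtain a b where p: "p = a *\<^sub>R e1 + b *\<^sub>R e2" "u1 * a + u2 * b + u0 = 0"
    using u(2) I(1) unfolding coord_line_def by blast
  obtain c d where q: "q = c *\<^sub>R e1 + d *\<^sub>R e2" "u1 * c + u2 * d + u0 = 0"
    using u(2) I(2) unfolding coord_line_def by blast
  have p': "v1 * a + v2 * b + v0 = 0"
    using v(2) I(1) p(1) coordinate_system_unique[OF cs] unfolding coord_line_def by blast
  have q': "v1 * c + v2 * d + v0 = 0"
    using v(2) I(2) q(1) coordinate_system_unique[OF cs] unfolding coord_line_def by blast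
  define x where "x = a - c"
  define y where "y = b - d"
  have xy: "x \<noteq> 0 \<or> y \<noteq> 0" using p(1) q(1) I(3) unfolding x_def y_def by auto
  have U: "u1 * x + u2 * y = 0" using p(2) q(2) unfolding x_def y_def by (simp add: algebra_simps)
  have V: "v1 * x + v2 * y = 0" using p' q' unfolding x_def y_def by (simp add: algebra_simps)
  show "s = (if u2 = 0 then \<infinity> else ereal (- u1 / u2))"
  proof (cases "x = 0")
    case True
    with xy U V have "u2 = 0" "v2 = 0" by auto
    with s show ?thesis by simp
  next
    case False
    then have "u1 = - u2 * y / x" "v1 = - v2 * y / x" using U V by (simp_all add: field_simps)
    with u(1) v(1) s show ?thesis by auto
  qed
qed

end

theory Submission
  imports Defs
begin

text \<open>From (ii) to (i): since there are $O(N)$ distances up to $N$, arbitrarily far out there are windows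
  of length $w$ containing $O(w)$ distances. If a finite \<open>P \<subseteq> S\<close> has more points than such a window
  has distances, every far away point of \<open>S\<close> is equidistant from two points of \<open>P\<close>; in the limit every
  boundary point of the ball gets a supporting line parallel to one of the finitely many directions
  \<open>p - q\<close>, so the ball is a polygon. For a functional \<open>f\<close> supporting a side, the differences of
  \<open>f(S)\<close> are uniformly locally finite, so by an argument of Lagarias every additive
  \<open>\<lambda> : \<real> \<rightarrow> \<real>\<close> is linear up to a bounded error on them, with a slope \<open>c(\<lambda>)\<close>. Normalising
  three functionals to \<open>x\<close>, \<open>y\<close>, \<open>x + y\<close> makes these slopes equal, and a fourth one
  \<open>x + t y\<close> gives \<open>c(\<lambda> \<circ> t) = t c(\<lambda>)\<close>. The slopes of the coordinate maps of a rational basis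
  span a finite-dimensional rational space, so \<open>t\<close> is algebraic.

  From (i) to (ii): integer vectors near a common right eigenvector of the (rational) matrices of
  multiplication by the slopes give a relatively dense \<open>A \<subseteq> \<real>\<close> such that all sets
  \<open>(A - A) - s (A - A)\<close> have $O(N)$ elements up to $N$; take \<open>S = A e\<^sub>1 + A e\<^sub>2\<close>.\<close>

section \<open>Almost linear maps on relatively dense sets of reals\<close>

text \<open>The hypothesis on \<open>S\<close> counts distances and shows no arithmetic. Three
  functionals cannot reveal any either: up to scaling, a change of basis brings any three pairwise
  independent ones to x, y, x + y. Algebraicity can only come from a fourth one, and wild additive
  maps are used because they separate the rational structure of differences from their real size. In
  the converse, integer combinations of 1 and an irrational slope are dense in the line, so the
  coefficient vectors must be confined to a strip. Multiplication by the slope preserves such a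
  strip, up to its width, because the axis is an eigenvector, and values grow in proportion to the
  position along the axis because the axis is not orthogonal to the vector of powers, the left
  eigenvector. For a companion matrix this non-orthogonality means that the slope is a simple root,
  which an integer polynomial of least degree ensures; tensor products of companion matrices serve
  several slopes at once.\<close>

lemma sparse_windows:
  fixes D :: "real set"
  assumes nonneg: "\<And>d. d \<in> D \<Longrightarrow> 0 \<le> d"
    and D: "\<And>N. N \<ge> N0 \<Longrightarrow>
      finite (D \<inter> {..real N}) \<and> real (card (D \<inter> {..real N})) \<le> C * real N"
    and C: "C \<ge> 0" and w: "1 \<le> w"
  shows "\<exists>R\<ge>R0. real (card (D \<inter> {R..R+w})) \<le> (8*C+1) * w \<and>
    real (card (D \<inter> {R-x..R-x+w})) \<le> (8*C+1) * w"
proof (rule ccontr)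
  define g where "g R = real (card (D \<inter> {R..R+w}))" for R
  assume "\<not> ?thesis"
  then have "\<not> (g R \<le> (8*C+1) * w \<and> g (R - x) \<le> (8*C+1) * w)" if "R \<ge> R0" for R
    using that unfolding g_def by blast
  moreover have "g R \<ge> 0" for R by (simp add: g_def)
  \<comment> \<open>Failure at \<open>R\<close> means that one of the two counts is too large, hence
    so is their sum; it is the sum that can be averaged over many \<open>R\<close>.\<close>
  ultimately have big: "g R + g (R - x) \<ge> (8*C+1) * w" if "R \<ge> R0" for R
    using that by (smt (verit))
  \<comment> \<open>\<open>E\<close> collects the part of \<open>N\<close> that does not grow with
    \<open>n\<close>, with 1 for rounding up. Windows at spacing \<open>2*w\<close> are disjoint,
    and the two families of \<open>n\<close> windows together meet at most \<open>2*C*N\<close>,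
    about \<open>4*C*w*n\<close>, distances: too few for the constant \<open>8*C+1\<close>.\<close>
  define E where "E = \<bar>R0\<bar> + \<bar>x\<bar> + w + 1 + real N0"
  define n where "n = nat \<lceil>2 * C * E\<rceil> + 1"
  define N where "N = nat \<lceil>\<bar>R0\<bar> + \<bar>x\<bar> + w + 2*w*real n\<rceil> + N0"
  have N1: "real N \<ge> \<bar>R0\<bar> + \<bar>x\<bar> + w + 2*w*real n" unfolding N_def by linarith
  have "0 \<le> 2*w*real n" using w by simp
  then have N2: "real N \<le> E + 2*w*real n" unfolding N_def E_def using w by simp linarith
  have fin: "finite (D \<inter> {..real N})" and card: "real (card (D \<inter> {..real N})) \<le> C * real N"
    using D[of N] by (auto simp: N_def)
  have sum: "(\<Sum>k<n. g (a + 2*w*real k)) \<le> C * real N" if a: "a \<le> \<bar>R0\<bar> + \<bar>x\<bar>" for a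
  proof -
    let ?W = "\<lambda>k. D \<inter> {a + 2*w*real k..a + 2*w*real k + w}"
    have sub: "?W k \<subseteq> D \<inter> {..real N}" if "k < n" for k
    proof -
      have "2*w*real k \<le> 2*w*real n" using that w by simp
      then show ?thesis using N1 a by auto
    qed
    have disj: "?W k \<inter> ?W l = {}" if "k < l" for k l
    proof -
      have "2*w*(real k + 1) \<le> 2*w*real l" using that w by (intro mult_left_mono) auto
      then show ?thesis using w by (auto simp: algebra_simps)
    qed
    have "(\<Sum>k<n. card (?W k)) = card (\<Union>k<n. ?W k)"
    proof (rule card_UN_disjoint[symmetric])
      show "\<forall>i\<in>{..<n}. finite (?W i)" using sub fin by (meson finite_subset lessThan_iff)
      show "\<forall>i\<in>{..<n}. \<forall>j\<in>{..<n}. i \<noteq> j \<longrightarrow> ?W i \<inter> ?W j = {}"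
      proof (intro ballI impI)
        fix i j :: nat
        assume "i \<noteq> j"
        then consider "i < j" | "j < i" by linarith
        then show "?W i \<inter> ?W j = {}" by cases (use disj[of i j] disj[of j i] in blast)+
      qed
    qed simp
    also have "\<dots> \<le> card (D \<inter> {..real N})" using sub fin by (intro card_mono) blast+
    finally have "real (\<Sum>k<n. card (?W k)) \<le> real (card (D \<inter> {..real N}))"
      using of_nat_mono by blast
    then show ?thesis using card unfolding g_def by simp
  qed
  have "real n * ((8*C+1) * w) = (\<Sum>k<n. (8*C+1) * w)" by simp
  also have "\<dots> \<le> (\<Sum>k<n. g (R0 + 2*w*real k) + g (R0 - x + 2*w*real k))"
  proof (rule sum_mono)
    fix k
    have "0 \<le> 2*w*real k" using w by simp
    then show "(8*C+1) * w \<le> g (R0 + 2*w*real k) + g (R0 - x + 2*w*real k)"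
      using big[of "R0 + 2*w*real k"] by (simp add: algebra_simps)
  qed
  also have "\<dots> \<le> C * real N + C * real N"
    unfolding sum.distrib by (intro add_mono sum) linarith+
  also have "\<dots> = 2 * C * real N" by simp
  also have "\<dots> \<le> 2 * C * (E + 2*w*real n)" using N2 C by (intro mult_left_mono) auto
  finally have "real n * w * (4*C+1) \<le> 2*C*E" by (simp add: algebra_simps)
  moreover have "real n * 1 * 1 \<le> real n * w * (4*C+1)" using w C by (intro mult_mono) auto
  moreover have "real n > 2*C*E" unfolding n_def by linarith
  ultimately show False by linarith
qed

text \<open>Only distinct values cost a step, so the bound is independent of \<open>n\<close> and
  controls arbitrarily long walks.\<close>

lemma abs_diff_chain_le:
  fixes u :: "nat \<Rightarrow> real"
  assumes "finite V" "\<And>i. i \<le> n \<Longrightarrow> u i \<in> V" "\<And>i. i < n \<Longrightarrow> \<bar>u (Suc i) - u i\<bar> \<le> b" "b \<ge> 0"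
  shows "\<bar>u n - u 0\<bar> \<le> b * real (card V)"
  using assms
proof (induction "card V" arbitrary: V u n rule: less_induct)
  case less
  \<comment> \<open>After the last visit to \<open>u 0\<close> the chain runs in a set with one element less.\<close>
  define i where "i = Max {i. i \<le> n \<and> u i = u 0}"
  have I: "finite {i. i \<le> n \<and> u i = u 0}" "{i. i \<le> n \<and> u i = u 0} \<noteq> {}" by auto
  have i: "i \<le> n" "u i = u 0" using Max_in[OF I] unfolding i_def by auto
  have late: "u j \<noteq> u 0" if "i < j" "j \<le> n" for j
  proof
    assume "u j = u 0"
    then have "j \<le> i" using Max_ge[OF I(1), of j] that unfolding i_def by simp
    with that show False by simp
  qed
  have u0: "u 0 \<in> V" using less.prems(2) by simp
  then have card: "real (card V) = real (card (V - {u 0})) + 1"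
    using card.remove[OF \<open>finite V\<close> u0] by simp
  show ?case
  proof (cases "i = n")
    case True
    then show ?thesis using i less.prems(4) by simp
  next
    case False
    define v where "v j = u (Suc i + j)" for j
    have "\<bar>v (n - Suc i) - v 0\<bar> \<le> b * real (card (V - {u 0}))"
    proof (rule less.hyps)
      show "card (V - {u 0}) < card V" using card by linarith
      show "finite (V - {u 0})" using \<open>finite V\<close> by simp
      show "v j \<in> V - {u 0}" if "j \<le> n - Suc i" for j
        using that False i late[of "Suc i + j"] less.prems(2)[of "Suc i + j"] unfolding v_def by auto
      show "\<bar>v (Suc j) - v j\<bar> \<le> b" if "j < n - Suc i" for j
        using that less.prems(3)[of "Suc i + j"] unfolding v_def by auto
    qed (rule less.prems(4))
    moreover have "v (n - Suc i) = u n" using False i unfolding v_def by simp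
    moreover have "\<bar>v 0 - u 0\<bar> \<le> b" using less.prems(3)[of i] False i unfolding v_def by simp
    ultimately show ?thesis unfolding card by (simp add: algebra_simps)
  qed
qed

lemma quasi_additive_nat:
  fixes \<phi> :: "real \<Rightarrow> real"
  assumes "\<And>x y. \<bar>\<phi> (x + y) - \<phi> x - \<phi> y\<bar> \<le> K"
  shows "\<bar>\<phi> (real (Suc n) * x) - real (Suc n) * \<phi> x\<bar> \<le> real n * K"
proof (induction n)
  case (Suc n)
  have "real (Suc (Suc n)) * x = real (Suc n) * x + x" by (simp add: algebra_simps)
  then show ?case using Suc assms[of "real (Suc n) * x" x] by (simp add: algebra_simps abs_le_iff)
qed simp

text \<open>This is Hyers' stability argument: lower and upper estimates of the slope from different
  integers are compatible, so a common slope fits between them. Boundedness on the unit interval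
  excludes additive maps that are not linear.\<close>

lemma quasi_additive_imp_nearly_linear:
  fixes \<phi> :: "real \<Rightarrow> real"
  assumes qa: "\<And>x y. \<bar>\<phi> (x + y) - \<phi> x - \<phi> y\<bar> \<le> K"
    and bdd: "\<And>x. 0 \<le> x \<Longrightarrow> x \<le> 1 \<Longrightarrow> \<bar>\<phi> x\<bar> \<le> M"
  shows "\<exists>c C. \<forall>x. \<bar>\<phi> x - c * x\<bar> \<le> C"
proof -
  have K: "K \<ge> 0" using qa[of 0 0] by linarith
  \<comment> \<open>\<phi> is evaluated at the product of the two integers, seen as a multiple of
    either.\<close>
  have cmp: "(\<phi> (real (Suc n)) - K) / real (Suc n) \<le> (\<phi> (real (Suc m)) + K) / real (Suc m)" for n m
  proof -
    have 1: "real (Suc m) * (\<phi> (real (Suc n)) - K) \<le> \<phi> (real (Suc m) * real (Suc n))"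
      using quasi_additive_nat[of \<phi> K m "real (Suc n)", OF qa] K by (simp add: algebra_simps abs_le_iff)
    have 2: "\<phi> (real (Suc n) * real (Suc m)) \<le> real (Suc n) * (\<phi> (real (Suc m)) + K)"
      using quasi_additive_nat[of \<phi> K n "real (Suc m)", OF qa] K by (simp add: algebra_simps abs_le_iff)
    have "real (Suc m) * (\<phi> (real (Suc n)) - K) \<le> real (Suc n) * (\<phi> (real (Suc m)) + K)"
      using 1 2 by (simp only: mult.commute[of "real (Suc m)" "real (Suc n)"])
    then show ?thesis by (simp add: divide_simps mult.commute)
  qed
  define c where "c = (SUP n. (\<phi> (real (Suc n)) - K) / real (Suc n))"
  have bdd': "bdd_above (range (\<lambda>n. (\<phi> (real (Suc n)) - K) / real (Suc n)))"
    by (rule bdd_aboveI[of _ "(\<phi> (real (Suc 0)) + K) / real (Suc 0)"]) (use cmp[of _ 0] in auto)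
  have low: "(\<phi> (real (Suc n)) - K) / real (Suc n) \<le> c" for n
    unfolding c_def by (rule cSUP_upper[OF _ bdd']) simp
  have up: "c \<le> (\<phi> (real (Suc n)) + K) / real (Suc n)" for n
    unfolding c_def by (rule cSUP_least) (use cmp in auto)
  have nat: "\<bar>\<phi> (real (Suc n)) - c * real (Suc n)\<bar> \<le> K" for n
    using low[of n] up[of n] by (simp add: divide_simps abs_le_iff algebra_simps)
  have z: "\<bar>\<phi> 0\<bar> \<le> K" using qa[of 0 0] by simp
  have pos: "\<bar>\<phi> (real n) - c * real n\<bar> \<le> K" for n
    using nat[of "n - 1"] z by (cases n) auto
  have int: "\<bar>\<phi> (real_of_int n) - c * real_of_int n\<bar> \<le> 3 * K" for n
  proof (cases "n \<ge> 0")
    case True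
    then show ?thesis using pos[of "nat n"] K by simp
  next
    case False
    then show ?thesis using pos[of "nat (- n)"] qa[of "real_of_int n" "- real_of_int n"] z
      by (simp add: abs_le_iff)
  qed
  have "\<bar>\<phi> x - c * x\<bar> \<le> 4 * K + M + \<bar>c\<bar>" for x
  proof -
    have "\<bar>c * frac x\<bar> \<le> \<bar>c\<bar> * 1"
      unfolding abs_mult using frac_lt_1[of x] frac_ge_0[of x] by (intro mult_left_mono) auto
    moreover have "\<bar>\<phi> (frac x)\<bar> \<le> M" using bdd[of "frac x"] frac_lt_1[of x] frac_ge_0[of x] by simp
    moreover have "c * x = c * real_of_int \<lfloor>x\<rfloor> + c * frac x"
      by (simp add: frac_def algebra_simps)
    moreover have "\<bar>\<phi> x - \<phi> (real_of_int \<lfloor>x\<rfloor>) - \<phi> (frac x)\<bar> \<le> K"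
      using qa[of "real_of_int \<lfloor>x\<rfloor>" "frac x"] by (simp add: frac_def)
    ultimately show ?thesis using int[of "\<lfloor>x\<rfloor>"] by (simp add: abs_le_iff)
  qed
  then show ?thesis by blast
qed

definition differences :: "'a::ab_group_add set \<Rightarrow> 'a set" where
  "differences A = {a - b | a b. a \<in> A \<and> b \<in> A}"

definition uniformly_locally_finite :: "real set \<Rightarrow> bool" where
  "uniformly_locally_finite G \<longleftrightarrow>
     (\<forall>w. \<exists>C. \<forall>x. finite (G \<inter> {x..x+w}) \<and> card (G \<inter> {x..x+w}) \<le> C)"

definition relatively_dense :: "real set \<Rightarrow> bool" where
  "relatively_dense A \<longleftrightarrow> (\<exists>M. \<forall>x. \<exists>a\<in>A. \<bar>x - a\<bar> \<le> M)"

definition asymptotic_slope :: "real set \<Rightarrow> (real \<Rightarrow> real) \<Rightarrow> real \<Rightarrow> bool" where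
  "asymptotic_slope G f c \<longleftrightarrow> (\<exists>C. \<forall>x\<in>G. \<bar>f x - c * x\<bar> \<le> C)"

text \<open>This is Lagarias' argument for Meyer sets: if \<open>z\<close> moves through the line, the difference of the
  points of \<open>A\<close> nearest to \<open>z + d\<close> and \<open>z\<close> changes only among finitely many
  values, in steps of bounded \<open>f\<close>-size.\<close>

lemma additive_nearly_linear_on_differences:
  assumes "relatively_dense A" and ulf: "uniformly_locally_finite (differences A)" and "Modules.additive f"
  shows "\<exists>c. asymptotic_slope (differences A) f c"
proof -
  interpret Modules.additive f by fact
  obtain M where M: "\<And>x. \<exists>a\<in>A. \<bar>x - a\<bar> \<le> M" using assms(1) unfolding relatively_dense_def by blast
  have M0: "M \<ge> 0" using M[of 0] by force
  define near where "near x = (SOME a. a \<in> A \<and> \<bar>x - a\<bar> \<le> M)" for x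
  have near: "near x \<in> A" "\<bar>x - near x\<bar> \<le> M" for x
    using someI_ex[of "\<lambda>a. a \<in> A \<and> \<bar>x - a\<bar> \<le> M"] M[of x] unfolding near_def by auto
  \<comment> \<open>Points at distance at most 1 have chosen neighbours at distance at most
    \<open>2*M+1\<close>, so the maximum \<open>b\<close> bounds the change of \<open>f\<close>
    between these neighbours.\<close>
  define F where "F = differences A \<inter> {- (2*M+1)..2*M+1}"
  have "\<exists>C. \<forall>x. finite (differences A \<inter> {x..x+2*(2*M+1)}) \<and> card (differences A \<inter> {x..x+2*(2*M+1)}) \<le> C"
    using ulf unfolding uniformly_locally_finite_def by blast
  then obtain C0 where "\<forall>x. finite (differences A \<inter> {x..x+2*(2*M+1)}) \<and> card (differences A \<inter> {x..x+2*(2*M+1)}) \<le> C0" by blast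
  then have "finite (differences A \<inter> {- (2*M+1)..- (2*M+1)+2*(2*M+1)})" by blast
  then have finF: "finite F" unfolding F_def by simp
  define b where "b = Max (insert 0 ((\<lambda>x. \<bar>f x\<bar>) ` F))"
  have b: "\<bar>f x\<bar> \<le> b" if "x \<in> F" for x unfolding b_def using finF that by (intro Max_ge) auto
  have b0: "b \<ge> 0" unfolding b_def using finF by (intro Max_ge) auto
  have step: "\<bar>f a - f a'\<bar> \<le> b" if "a \<in> A" "a' \<in> A" "\<bar>a - a'\<bar> \<le> 2*M+1" for a a'
  proof -
    have "a - a' \<in> F" using that unfolding F_def differences_def by (auto simp: abs_le_iff)
    then show ?thesis using b diff by metis
  qed
  obtain C where C: "\<And>x. finite (differences A \<inter> {x..x+4*M})"
      "\<And>x. card (differences A \<inter> {x..x+4*M}) \<le> C"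
    using ulf unfolding uniformly_locally_finite_def by meson
  define g where "g d z = near (z + d) - near z" for d z
  have gin: "g d z \<in> differences A \<inter> {d-2*M..d-2*M+4*M}" for d z
    using near[of z] near[of "z + d"] unfolding g_def differences_def by (auto simp: abs_le_iff)
  have gstep: "\<bar>f (g d z) - f (g d z')\<bar> \<le> 2*b" if "\<bar>z - z'\<bar> \<le> 1" for d z z'
  proof -
    have "\<bar>near z - near z'\<bar> \<le> 2*M+1" "\<bar>near (z+d) - near (z'+d)\<bar> \<le> 2*M+1"
      using that near(2)[of z] near(2)[of z'] near(2)[of "z+d"] near(2)[of "z'+d"] by auto
    then have "\<bar>f (near z) - f (near z')\<bar> \<le> b" "\<bar>f (near (z+d)) - f (near (z'+d))\<bar> \<le> b"
      using step near(1) by auto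
    then show ?thesis unfolding g_def diff by linarith
  qed
  define K where "K = 2 * b * real C"
  have gvar: "\<bar>f (g d z) - f (g d z')\<bar> \<le> K" for d z z'
  proof -
    \<comment> \<open>The way from \<open>z'\<close> to \<open>z\<close> is cut into
      \<open>n\<close> steps shorter than 1. The values stay in the image of a single window with at
      most \<open>C\<close> points, whatever \<open>n\<close> is.\<close>
    obtain n :: nat where n: "\<bar>z - z'\<bar> < real n" using reals_Archimedean2 by blast
    then have n0: "n > 0" by auto
    define u where "u i = f (g d (z' + real i / real n * (z - z')))" for i
    let ?V = "f ` (differences A \<inter> {d-2*M..d-2*M+4*M})"
    have "\<bar>u n - u 0\<bar> \<le> 2*b * real (card ?V)"
    proof (rule abs_diff_chain_le)
      show "finite ?V" by (rule finite_imageI, rule C)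
      show "u i \<in> ?V" for i unfolding u_def using gin by blast
      show "\<bar>u (Suc i) - u i\<bar> \<le> 2*b" for i unfolding u_def
      proof (rule gstep)
        have "z' + real (Suc i) / real n * (z - z') - (z' + real i / real n * (z - z')) = (z - z') / real n"
          by (simp add: add_divide_distrib distrib_right)
        then show "\<bar>z' + real (Suc i) / real n * (z - z') - (z' + real i / real n * (z - z'))\<bar> \<le> 1"
          using n n0 by simp
      qed
    qed (use b0 in simp)
    also have "\<dots> \<le> 2*b * real C"
      using b0 by (intro mult_left_mono of_nat_mono order_trans[OF card_image_le[OF C(1)] C(2)]) auto
    finally show ?thesis unfolding u_def K_def using n0 by simp
  qed
  define \<phi> where "\<phi> d = f (g d 0)" for d
  have "\<exists>c C. \<forall>x. \<bar>\<phi> x - c * x\<bar> \<le> C"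
  proof (rule quasi_additive_imp_nearly_linear)
    show "\<bar>\<phi> (x + y) - \<phi> x - \<phi> y\<bar> \<le> K" for x y
    proof -
      \<comment> \<open>This cocycle identity turns the near independence of \<open>g y\<close> from
        its base point into quasi-additivity of \<phi>.\<close>
      have "g (x + y) 0 = g y x + g x 0" unfolding g_def by simp
      then show ?thesis unfolding \<phi>_def using gvar[of y x 0] by (simp add: add)
    qed
    show "\<bar>\<phi> x\<bar> \<le> b" if "0 \<le> x" "x \<le> 1" for x
      unfolding \<phi>_def g_def diff using near[of 0] near[of x] that by (intro step) auto
  qed
  then obtain c C' where c: "\<And>x. \<bar>\<phi> x - c * x\<bar> \<le> C'" by blast
  have "\<bar>f x - c * x\<bar> \<le> C' + K + 2*b" if "x \<in> differences A" for x
  proof -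
    obtain p q where pq: "p \<in> A" "q \<in> A" "x = p - q" using \<open>x \<in> differences A\<close> unfolding differences_def by blast
    \<comment> \<open>Based at \<open>q\<close> instead of 0, \<open>g x\<close> compares the points
      chosen near \<open>p\<close> and near \<open>q\<close>, so it approximates \<open>x\<close>
      itself.\<close>
    have "g x q = near p - near q" unfolding g_def pq by simp
    then have "f (g x q) - f x = (f (near p) - f p) - (f (near q) - f q)" by (simp add: pq diff)
    moreover have "\<bar>f (near p) - f p\<bar> \<le> b" "\<bar>f (near q) - f q\<bar> \<le> b"
      using near[of p] near[of q] M0 pq by (auto intro!: step)
    moreover have "\<bar>f (g x q) - \<phi> x\<bar> \<le> K" unfolding \<phi>_def by (rule gvar)
    ultimately show ?thesis using c[of x] by (simp add: abs_le_iff)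
  qed
  then show ?thesis unfolding asymptotic_slope_def by blast
qed

section \<open>Slopes of additive maps and algebraic numbers\<close>

interpretation Q: vector_space "\<lambda>(q::rat) (x::real). of_rat q * x"
  by unfold_locales (auto simp: algebra_simps of_rat_add of_rat_mult)

text \<open>All numbers \<open>t ^ k * u\<close> lie in one rational space of finite dimension, so
  they satisfy a rational relation; cancelling \<open>u\<close> makes it a polynomial with root
  \<open>t\<close>.\<close>

lemma algebraic_if_stable_span:
  fixes t u :: real
  assumes T: "finite T" and u: "u \<in> Q.span T" "u \<noteq> 0"
    and stable: "\<And>x. x \<in> T \<Longrightarrow> t * x \<in> Q.span T"
  shows "algebraic t"
proof -
  have tspan: "t * x \<in> Q.span T" if "x \<in> Q.span T" for x
    using that
  proof (induction rule: Q.span_induct_alt)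
    case base
    then show ?case by (simp add: Q.span_zero)
  next
    case (step q x y)
    have "t * (of_rat q * x + y) = of_rat q * (t * x) + t * y" by (simp add: algebra_simps)
    then show ?case using step stable by (auto intro: Q.span_add Q.span_scale)
  qed
  have pow: "t ^ k * u \<in> Q.span T" for k
    by (induction k) (use u tspan in \<open>auto simp: mult.assoc\<close>)
  show ?thesis
  proof (cases "inj (\<lambda>k. t ^ k * u)")
    \<comment> \<open>If two of the numbers coincide, dependence of their set is no relation between
      indices; but then \<open>t\<close> is a root of a difference of monomials.\<close>
    case False
    then obtain k l where kl: "k \<noteq> l" "t ^ k = t ^ l" using u by (auto simp: inj_def)
    define p :: "real poly" where "p = monom 1 k - monom 1 l"
    have "coeff p k = 1" using kl by (simp add: p_def)
    then have "p \<noteq> 0" by auto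
    moreover have "poly p t = 0" using kl by (simp add: p_def poly_monom)
    moreover have "\<forall>i. coeff p i \<in> \<rat>" by (simp add: p_def)
    ultimately show ?thesis unfolding algebraic_altdef by blast
  next
    case True
    define n where "n = card T"
    let ?S = "(\<lambda>k. t ^ k * u) ` {..n}"
    have "card ?S = Suc n" using True by (simp add: card_image inj_on_subset)
    moreover have "?S \<subseteq> Q.span T" using pow by blast
    ultimately have "Q.dependent ?S"
      using Q.independent_span_bound[OF T, of ?S] unfolding n_def by fastforce
    then obtain a s where a: "s \<in> ?S" "a s \<noteq> 0" "(\<Sum>v\<in>?S. of_rat (a v) * v) = 0"
      using Q.dependent_finite[of ?S] by auto
    obtain k where k: "k \<le> n" "s = t ^ k * u" using a by blast
    define p :: "real poly" where "p = (\<Sum>k\<le>n. monom (of_rat (a (t ^ k * u))) k)"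
    have cp: "coeff p i = (if i \<le> n then of_rat (a (t ^ i * u)) else 0)" for i
      unfolding p_def coeff_sum coeff_monom by (simp add: sum.delta)
    have "p \<noteq> 0" using cp[of k] k a by auto
    moreover have "\<forall>i. coeff p i \<in> \<rat>" by (simp add: cp)
    moreover have "poly p t = 0"
    proof -
      have "0 = (\<Sum>k\<le>n. of_rat (a (t ^ k * u)) * (t ^ k * u))"
        using a(3) sum.reindex[of "\<lambda>k. t ^ k * u" "{..n}" "\<lambda>v. of_rat (a v) * v"] True
        by (simp add: inj_on_subset)
      also have "\<dots> = poly p t * u"
        unfolding p_def by (simp add: poly_sum poly_monom sum_distrib_right mult.assoc)
      finally show ?thesis using u by simp
    qed
    ultimately show ?thesis unfolding algebraic_altdef by blast
  qed
qed

text \<open>The basis is one of all reals over the rationals, so that the coordinate maps are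
  additive everywhere and asymptotic slopes apply to them; on the span of a finite set only finitely
  many of them matter.\<close>

lemma rational_coordinates:
  assumes "finite F"
  obtains B0 and l :: "real \<Rightarrow> real \<Rightarrow> rat"
  where "finite B0" "\<And>b. Modules.additive (\<lambda>x. real_of_rat (l b x))"
    "\<And>x. x \<in> Q.span F \<Longrightarrow> x = (\<Sum>b\<in>B0. of_rat (l b x) * b)"
proof -
  obtain B where B: "Q.independent B" "UNIV \<subseteq> Q.span B"
    using Q.maximal_independent_subset[of UNIV] by metis
  define l where "l b x = Q.representation B x b" for b x
  define B0 where "B0 = (\<Union>x\<in>F. {b. l b x \<noteq> 0})"
  have spanB: "x \<in> Q.span B" for x using B by blast
  show ?thesis
  proof (rule that)
    show "finite B0" unfolding B0_def l_def using assms by (simp add: Q.finite_representation)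
    show "Modules.additive (\<lambda>x. real_of_rat (l b x))" for b
      unfolding l_def by (rule additive.intro) (simp add: Q.representation_add[OF B(1)] spanB of_rat_add)
    fix x assume "x \<in> Q.span F"
    then have "l b x = 0" if "b \<notin> B0" for b
    proof (induction rule: Q.span_induct_alt)
      case base
      then show ?case by (simp add: l_def Q.representation_zero)
    next
      case (step q x y)
      then show ?case using that
        by (auto simp: B0_def l_def Q.representation_add[OF B(1)] Q.representation_scale[OF B(1)] spanB)
    qed
    then have "(\<Sum>b\<in>B0. of_rat (l b x) * b) = (\<Sum>b | l b x \<noteq> 0. of_rat (l b x) * b)"
      by (intro sum.mono_neutral_right) (auto simp: \<open>finite B0\<close>)
    also have "\<dots> = x" unfolding l_def by (rule Q.sum_nonzero_representation_eq[OF B(1) spanB])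
    finally show "x = (\<Sum>b\<in>B0. of_rat (l b x) * b)" ..
  qed
qed

definition has_asymptotic_slopes :: "real set \<Rightarrow> bool" where
  "has_asymptotic_slopes G \<longleftrightarrow> (\<forall>f. Modules.additive f \<longrightarrow> (\<exists>c. asymptotic_slope G f c))"

lemma asymptotic_slope_scale:
  "asymptotic_slope G f c \<Longrightarrow> asymptotic_slope G (\<lambda>x. r * f x) (r * c)"
proof -
  assume "asymptotic_slope G f c"
  then obtain C where C: "\<And>x. x \<in> G \<Longrightarrow> \<bar>f x - c * x\<bar> \<le> C" unfolding asymptotic_slope_def by blast
  have "\<bar>r * f x - r * c * x\<bar> \<le> \<bar>r\<bar> * C" if "x \<in> G" for x
  proof -
    have "\<bar>r * f x - r * c * x\<bar> = \<bar>r\<bar> * \<bar>f x - c * x\<bar>"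
      by (simp add: abs_mult[symmetric] algebra_simps)
    then show ?thesis using C[OF that] by (simp add: mult_left_mono)
  qed
  then show ?thesis unfolding asymptotic_slope_def by blast
qed

lemma asymptotic_slope_add:
  assumes "asymptotic_slope G f c" "asymptotic_slope G g d"
  shows "asymptotic_slope G (\<lambda>x. f x + g x) (c + d)"
proof -
  obtain C where C: "\<And>x. x \<in> G \<Longrightarrow> \<bar>f x - c * x\<bar> \<le> C"
    using assms(1) unfolding asymptotic_slope_def by blast
  obtain D where D: "\<And>x. x \<in> G \<Longrightarrow> \<bar>g x - d * x\<bar> \<le> D"
    using assms(2) unfolding asymptotic_slope_def by blast
  have "\<bar>f x + g x - (c + d) * x\<bar> \<le> C + D" if "x \<in> G" for x
    using C[OF that] D[OF that] by (simp add: algebra_simps abs_le_iff)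
  then show ?thesis unfolding asymptotic_slope_def by blast
qed

lemma asymptotic_slope_sum:
  assumes "finite I" "\<And>i. i \<in> I \<Longrightarrow> asymptotic_slope G (f i) (c i)"
  shows "asymptotic_slope G (\<lambda>x. \<Sum>i\<in>I. f i x) (\<Sum>i\<in>I. c i)"
  using assms
proof (induction I rule: finite_induct)
  case empty
  then show ?case by (auto simp: asymptotic_slope_def)
next
  case (insert i I)
  then show ?case by (simp add: asymptotic_slope_add)
qed

lemma asymptotic_slope_cong:
  assumes "asymptotic_slope G f c" "\<And>x. x \<in> G \<Longrightarrow> f x = g x"
  shows "asymptotic_slope G g c"
  using assms unfolding asymptotic_slope_def by auto

lemma asymptotic_slope_unique:
  assumes unb: "\<And>M. \<exists>x\<in>G. \<bar>x\<bar> > M" and "asymptotic_slope G f c" "asymptotic_slope G f d"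
  shows "c = d"
proof (rule ccontr)
  assume "c \<noteq> d"
  obtain C where C: "\<And>x. x \<in> G \<Longrightarrow> \<bar>f x - c * x\<bar> \<le> C"
    using assms(2) unfolding asymptotic_slope_def by blast
  obtain D where D: "\<And>x. x \<in> G \<Longrightarrow> \<bar>f x - d * x\<bar> \<le> D"
    using assms(3) unfolding asymptotic_slope_def by blast
  obtain x where x: "x \<in> G" "\<bar>x\<bar> > (C + D) / \<bar>c - d\<bar>" using unb by blast
  have "\<bar>(c - d) * x\<bar> \<le> C + D" using C[OF x(1)] D[OF x(1)] by (simp add: algebra_simps abs_le_iff)
  moreover have "\<bar>(c - d) * x\<bar> > C + D" using x(2) \<open>c \<noteq> d\<close>
    by (simp add: abs_mult pos_divide_less_eq mult.commute)
  ultimately show False by simp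
qed

lemma additive_mult_left: "Modules.additive f \<Longrightarrow> Modules.additive (\<lambda>x::real. f (t * x))"
  by (simp add: Modules.additive_def algebra_simps)

text \<open>Taking slopes is linear in the additive map. Applied to coordinate maps precomposed with
  multiplication by \<open>t\<close>, this shows that the coordinate slopes span a rational space
  stable under \<open>t\<close>.\<close>

lemma algebraic_if_slope_multiplicative:
  fixes t :: real
  assumes slopes: "has_asymptotic_slopes G" and unb: "\<And>M. \<exists>x\<in>G. \<bar>x\<bar> > M"
    and F: "finite F" "G \<subseteq> Q.span F"
    and mult: "\<And>f c. Modules.additive f \<Longrightarrow> asymptotic_slope G f c \<Longrightarrow>
      asymptotic_slope G (\<lambda>x. f (t * x)) (t * c)"
  shows "algebraic t"
proof -
  obtain B0 and l :: "real \<Rightarrow> real \<Rightarrow> rat" where B0: "finite B0"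
    and l: "\<And>b. Modules.additive (\<lambda>x. real_of_rat (l b x))"
    and rep: "\<And>x. x \<in> Q.span F \<Longrightarrow> x = (\<Sum>b\<in>B0. of_rat (l b x) * b)"
    using rational_coordinates[OF F(1)] by metis
  have "\<exists>s. asymptotic_slope G (\<lambda>x. of_rat (l b x)) s" for b
    using slopes l[of b] unfolding has_asymptotic_slopes_def by blast
  then obtain c where c: "\<And>b. asymptotic_slope G (\<lambda>x. of_rat (l b x)) (c b)" by metis
  \<comment> \<open>An additive map is on \<open>G\<close> a combination of the coordinate maps, hence so is its slope.\<close>
  have slope_eq: "s = (\<Sum>b\<in>B0. f b * c b)" if f: "Modules.additive f" and s: "asymptotic_slope G f s" for f s
  proof (rule asymptotic_slope_unique[OF unb s])
    have "asymptotic_slope G (\<lambda>x. \<Sum>b\<in>B0. f b * of_rat (l b x)) (\<Sum>b\<in>B0. f b * c b)"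
      by (rule asymptotic_slope_sum[OF B0 asymptotic_slope_scale[OF c]])
    moreover have "(\<Sum>b\<in>B0. f b * of_rat (l b x)) = f x" if "x \<in> G" for x
    proof -
      interpret f: Modules.additive f by fact
      have frat: "f (of_rat q * y) = of_rat q * f y" for q y
      proof -
        have nat: "f (of_nat n * y) = of_nat n * f y" for n y
          by (induction n) (simp_all add: algebra_simps f.add f.zero)
        have int: "f (of_int n * y) = of_int n * f y" for n y
          by (cases n rule: int_cases2) (use nat in \<open>simp_all add: f.minus\<close>)
        obtain a b where q: "q = Fract a b" "b > 0" by (cases q)
        have "of_int b * f (of_rat q * y) = f (of_int b * (of_rat q * y))" by (simp add: int)
        also have "of_int b * (of_rat q * y) = of_int a * y" using q by (simp add: of_rat_rat)
        also have "f \<dots> = of_int a * f y" by (rule int)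
        also have "\<dots> = of_int b * (of_rat q * f y)" using q by (simp add: of_rat_rat)
        finally show ?thesis using q by simp
      qed
      have "x \<in> Q.span F" using F(2) that by blast
      then have "f x = f (\<Sum>b\<in>B0. of_rat (l b x) * b)" by (intro arg_cong[of _ _ f] rep)
      also have "\<dots> = (\<Sum>b\<in>B0. f b * of_rat (l b x))" unfolding f.sum frat by (simp add: mult.commute)
      finally show ?thesis ..
    qed
    ultimately show "asymptotic_slope G f (\<Sum>b\<in>B0. f b * c b)" by (rule asymptotic_slope_cong)
  qed
  \<comment> \<open>The identity has slope 1, so the coordinate slopes cannot all vanish.\<close>
  have "asymptotic_slope G (\<lambda>x. x) 1" unfolding asymptotic_slope_def by (auto intro: exI[of _ 0])
  then have sum1: "(\<Sum>b\<in>B0. b * c b) = 1"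
    using slope_eq[of "\<lambda>x. x" 1] by (simp add: Modules.additive_def)
  have "\<not> (\<forall>b\<in>B0. c b = 0)"
  proof
    assume "\<forall>b\<in>B0. c b = 0"
    then have "(\<Sum>b\<in>B0. b * c b) = 0" by (intro sum.neutral) auto
    with sum1 show False by simp
  qed
  then obtain b0 where b0: "b0 \<in> B0" "c b0 \<noteq> 0" by blast
  \<comment> \<open>The coefficients on the right are rational because coordinate maps take rational
    values.\<close>
  have tc: "t * c b = (\<Sum>b'\<in>B0. of_rat (l b (t * b')) * c b')" for b
    by (rule slope_eq[OF additive_mult_left[OF l] mult[OF l c]])
  show ?thesis
  proof (rule algebraic_if_stable_span[of "c ` B0" "c b0"])
    show "t * x \<in> Q.span (c ` B0)" if "x \<in> c ` B0" for x
    proof -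
      from that obtain b where "x = c b" by (rule imageE)
      then show ?thesis unfolding \<open>x = c b\<close> tc by (intro Q.span_sum Q.span_scale Q.span_base imageI)
    qed
  qed (use b0 B0 in \<open>auto intro: Q.span_base\<close>)
qed

text \<open>As \<open>P\<close> is spread over the whole plane, a linear form bounded on it
  vanishes; an identity such as f(x + y) = f x + f y thus becomes an identity between
  slopes.\<close>

lemma algebraic_if_four_directions:
  fixes t :: real and P :: "(real \<times> real) set"
  assumes dense: "\<And>a b. \<exists>(x, y)\<in>P. \<bar>x - a\<bar> \<le> M \<and> \<bar>y - b\<bar> \<le> M"
    and s1: "has_asymptotic_slopes (fst ` P)" and s2: "has_asymptotic_slopes (snd ` P)"
    and s3: "has_asymptotic_slopes ((\<lambda>(x, y). x + y) ` P)"
    and s4: "has_asymptotic_slopes ((\<lambda>(x, y). x + t * y) ` P)"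
    and F: "finite F" "fst ` P \<subseteq> Q.span F"
  shows "algebraic t"
proof (rule algebraic_if_slope_multiplicative[OF s1 _ F])
  show "\<exists>x\<in>fst ` P. \<bar>x\<bar> > N" for N
  proof -
    obtain x y where "(x, y) \<in> P" "\<bar>x - (\<bar>N\<bar> + M + 1)\<bar> \<le> M" using dense by fast
    then show ?thesis by (intro bexI[of _ x]) force+
  qed
  have zero: "a = 0 \<and> b = 0" if bd: "\<And>x y. (x, y) \<in> P \<Longrightarrow> \<bar>a * x + b * y\<bar> \<le> C" for a b C
  proof (rule ccontr)
    assume "\<not> ?thesis"
    then have pos: "a\<^sup>2 + b\<^sup>2 > 0" by (simp add: sum_power2_gt_zero_iff)
    \<comment> \<open>At \<open>r\<close> times the vector (a, b) the form is larger than all errors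
      combined.\<close>
    define r where "r = (C + \<bar>a\<bar> * M + \<bar>b\<bar> * M + 1) / (a\<^sup>2 + b\<^sup>2)"
    obtain x y where xy: "(x, y) \<in> P" "\<bar>x - r * a\<bar> \<le> M" "\<bar>y - r * b\<bar> \<le> M" using dense by fast
    have "r * (a\<^sup>2 + b\<^sup>2) = a * x + b * y - a * (x - r * a) - b * (y - r * b)"
      by (simp add: algebra_simps power2_eq_square)
    moreover have "\<bar>a * (x - r * a)\<bar> \<le> \<bar>a\<bar> * M" "\<bar>b * (y - r * b)\<bar> \<le> \<bar>b\<bar> * M"
      using xy by (simp_all add: abs_mult mult_left_mono)
    ultimately have "r * (a\<^sup>2 + b\<^sup>2) \<le> C + \<bar>a\<bar> * M + \<bar>b\<bar> * M" using bd[OF xy(1)] by linarith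
    moreover have "r * (a\<^sup>2 + b\<^sup>2) = C + \<bar>a\<bar> * M + \<bar>b\<bar> * M + 1"
      unfolding r_def using pos by (metis less_irrefl nonzero_eq_divide_eq)
    ultimately show False by linarith
  qed
  have eq: "c1 = c2 \<and> c1 = c3" if f: "Modules.additive f" and c: "asymptotic_slope (fst ` P) f c1"
    "asymptotic_slope (snd ` P) f c2" "asymptotic_slope ((\<lambda>(x, y). x + y) ` P) f c3" for f c1 c2 c3
  proof -
    interpret f: Modules.additive f by fact
    obtain C1 C2 C3 where C: "\<And>x y. (x, y) \<in> P \<Longrightarrow> \<bar>f x - c1 * x\<bar> \<le> C1"
      "\<And>x y. (x, y) \<in> P \<Longrightarrow> \<bar>f y - c2 * y\<bar> \<le> C2"
      "\<And>x y. (x, y) \<in> P \<Longrightarrow> \<bar>f (x + y) - c3 * (x + y)\<bar> \<le> C3"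
      using c unfolding asymptotic_slope_def by fastforce
    have "\<bar>(c1 - c3) * x + (c2 - c3) * y\<bar> \<le> C1 + C2 + C3" if "(x, y) \<in> P" for x y
      using C[OF that] by (simp add: f.add algebra_simps abs_le_iff)
    from zero[OF this] show ?thesis by simp
  qed
  fix f c assume f: "Modules.additive f" and c: "asymptotic_slope (fst ` P) f c"
  interpret f: Modules.additive f by fact
  have ft: "Modules.additive (\<lambda>x. f (t * x))" using f by (rule additive_mult_left)
  obtain d d2 d3 where d: "asymptotic_slope (fst ` P) (\<lambda>x. f (t * x)) d"
    "asymptotic_slope (snd ` P) (\<lambda>x. f (t * x)) d2"
    "asymptotic_slope ((\<lambda>(x, y). x + y) ` P) (\<lambda>x. f (t * x)) d3"
    using s1 s2 s3 ft unfolding has_asymptotic_slopes_def by blast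
  have "d = d2" using eq[OF ft d] by simp
  obtain c4 where c4: "asymptotic_slope ((\<lambda>(x, y). x + t * y) ` P) f c4"
    using s4 f unfolding has_asymptotic_slopes_def by blast
  obtain C1 C2 C3 where C: "\<And>x y. (x, y) \<in> P \<Longrightarrow> \<bar>f x - c * x\<bar> \<le> C1"
    "\<And>x y. (x, y) \<in> P \<Longrightarrow> \<bar>f (t * y) - d2 * y\<bar> \<le> C2"
    "\<And>x y. (x, y) \<in> P \<Longrightarrow> \<bar>f (x + t * y) - c4 * (x + t * y)\<bar> \<le> C3"
    using c d(2) c4 unfolding asymptotic_slope_def by fastforce
  \<comment> \<open>In f(x + t y) = f x + f(t y) the coefficient of x gives \<open>c = c4\<close>,
    that of y gives \<open>d2 = t * c4\<close>.\<close>
  have "\<bar>(c - c4) * x + (d2 - t * c4) * y\<bar> \<le> C1 + C2 + C3" if "(x, y) \<in> P" for x y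
    using C[OF that] by (simp add: f.add algebra_simps abs_le_iff)
  from zero[OF this] have "d2 = t * c" by simp
  then show "asymptotic_slope (fst ` P) (\<lambda>x. f (t * x)) (t * c)" using d(1) \<open>d = d2\<close> by simp
qed

text \<open>Walking along the line in unit steps changes the chosen nearby point by one of finitely
  many short differences, so these generate all differences.\<close>

lemma differences_in_finite_span:
  assumes "relatively_dense A" and ulf: "uniformly_locally_finite (differences A)"
  obtains F where "finite F" "differences A \<subseteq> Q.span F"
proof -
  obtain M where M: "\<And>x. \<exists>a\<in>A. \<bar>x - a\<bar> \<le> M" using assms(1) unfolding relatively_dense_def by blast
  have M0: "M \<ge> 0" using M[of 0] by force
  obtain near where near: "\<And>x. near x \<in> A" "\<And>x. \<bar>x - near x\<bar> \<le> M" using M by metis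
  define F where "F = differences A \<inter> {- (2*M+1)..- (2*M+1)+2*(2*M+1)}"
  have F: "finite F" unfolding F_def using ulf unfolding uniformly_locally_finite_def by meson
  have base: "a - a' \<in> Q.span F" if "a \<in> A" "a' \<in> A" "\<bar>a - a'\<bar> \<le> 2*M+1" for a a'
    by (rule Q.span_base) (use that in \<open>auto simp: F_def differences_def abs_le_iff\<close>)
  have walk: "near z - near z' \<in> Q.span F" if "\<bar>z - z'\<bar> \<le> real n" for n z z'
    using that
  proof (induction n arbitrary: z)
    case 0
    then show ?case by (simp add: Q.span_zero)
  next
    case (Suc n)
    define y where "y = z - (z - z') / real (Suc n)"
    have "y - z' = real n * ((z - z') / real (Suc n))" unfolding y_def by (simp add: field_simps)
    moreover have z1: "\<bar>(z - z') / real (Suc n)\<bar> \<le> 1" using Suc.prems by simp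
    ultimately have y: "\<bar>y - z'\<bar> \<le> real n" "\<bar>z - y\<bar> \<le> 1"
      using mult_left_mono[OF z1, of "real n"] by (simp_all add: y_def abs_mult)
    have "\<bar>near z - near y\<bar> \<le> 2*M+1" using near(2)[of z] near(2)[of y] y(2) by linarith
    then have "near z - near y \<in> Q.span F" using near by (intro base)
    from Q.span_add[OF this Suc.IH[OF y(1)]] show ?case by simp
  qed
  have "differences A \<subseteq> Q.span F"
  proof
    fix x assume "x \<in> differences A"
    then obtain p q where pq: "p \<in> A" "q \<in> A" "x = p - q" unfolding differences_def by blast
    obtain n where n: "\<bar>p - q\<bar> \<le> real n" using real_arch_simple by blast
    have "p - near p \<in> Q.span F" "near q - q \<in> Q.span F"
      using near[of p] near[of q] M0 pq by (auto intro!: base)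
    then have "(p - near p) + (near p - near q) + (near q - q) \<in> Q.span F"
      by (intro Q.span_add walk[OF n])
    then show "x \<in> Q.span F" by (simp add: pq)
  qed
  with F show ?thesis by (rule that)
qed

section \<open>Norms on the plane\<close>

locale normed_plane =
  fixes nrm :: "real ^ 2 \<Rightarrow> real"
  assumes is_norm: "is_norm nrm"
begin

lemma nrm_eq_0_iff [simp]: "nrm x = 0 \<longleftrightarrow> x = 0"
  using is_norm unfolding is_norm_def by blast

lemma nrm_scaleR [simp]: "nrm (c *\<^sub>R x) = \<bar>c\<bar> * nrm x"
  using is_norm unfolding is_norm_def by blast

lemma nrm_triangle: "nrm (x + y) \<le> nrm x + nrm y"
  using is_norm unfolding is_norm_def by blast

lemma nrm_0 [simp]: "nrm 0 = 0"
  by (rule nrm_eq_0_iff[THEN iffD2]) (rule refl)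

lemma nrm_minus [simp]: "nrm (- x) = nrm x"
  using nrm_scaleR[of "-1" x] by simp

lemma nrm_minus_commute: "nrm (x - y) = nrm (y - x)"
  using nrm_minus[of "x - y"] by simp

lemma nrm_ge_0 [simp]: "0 \<le> nrm x"
  using nrm_triangle[of x "- x"] by simp

lemma nrm_triangle_sub: "nrm x \<le> nrm y + nrm (x - y)"
  using nrm_triangle[of y "x - y"] by simp

lemma nrm_triangle_diff: "nrm (x - z) \<le> nrm (x - y) + nrm (y - z)"
  using nrm_triangle[of "x - y" "y - z"] by simp

lemma nrm_le_norm: obtains \<beta> where "\<beta> > 0" "\<And>x. nrm x \<le> \<beta> * norm x"
proof
  define \<beta> where "\<beta> = (\<Sum>b\<in>Basis. nrm b) + 1"
  have s: "(\<Sum>b\<in>Basis. nrm b) \<ge> 0" by (simp add: sum_nonneg)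
  then show "\<beta> > 0" unfolding \<beta>_def by simp
  fix x :: "real ^ 2"
  have sum: "nrm (\<Sum>b\<in>B. f b) \<le> (\<Sum>b\<in>B. nrm (f b))" if "finite B" for f :: "real ^ 2 \<Rightarrow> real ^ 2" and B
    using that
  proof (induction B rule: finite_induct)
    case (insert b B)
    then show ?case using nrm_triangle[of "f b" "sum f B"] by simp
  qed simp
  have "nrm x = nrm (\<Sum>b\<in>Basis. (x \<bullet> b) *\<^sub>R b)" by (simp add: euclidean_representation)
  also have "\<dots> \<le> (\<Sum>b\<in>Basis. nrm ((x \<bullet> b) *\<^sub>R b))" by (rule sum) simp
  also have "\<dots> \<le> (\<Sum>b\<in>Basis. norm x * nrm b)"
    by (intro sum_mono) (simp add: Basis_le_norm mult_right_mono)
  also have "\<dots> = norm x * (\<Sum>b\<in>Basis. nrm b)" by (simp add: sum_distrib_left)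
  also have "\<dots> \<le> \<beta> * norm x" unfolding \<beta>_def by (simp add: algebra_simps)
  finally show "nrm x \<le> \<beta> * norm x" .
qed

lemma norm_le_nrm: obtains \<alpha> where "\<alpha> > 0" "\<And>x. norm x \<le> \<alpha> * nrm x"
proof -
  obtain \<beta> where \<beta>: "\<beta> > 0" "\<And>x. nrm x \<le> \<beta> * norm x" using nrm_le_norm by blast
  have "\<beta>-lipschitz_on UNIV nrm"
  proof (rule lipschitz_onI)
    fix x y
    have "nrm x - nrm y \<le> nrm (x - y)" "nrm y - nrm x \<le> nrm (x - y)"
      using nrm_triangle_sub[of x y] nrm_triangle_sub[of y x] nrm_minus_commute[of x y] by auto
    then show "dist (nrm x) (nrm y) \<le> \<beta> * dist x y"
      using \<beta>(2)[of "x - y"] unfolding dist_real_def dist_norm by linarith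
  qed (use \<beta> in simp)
  then have "continuous_on (sphere 0 1) nrm"
    using lipschitz_on_continuous_on continuous_on_subset by blast
  then obtain u where u: "u \<in> sphere 0 1" "\<And>x. x \<in> sphere 0 1 \<Longrightarrow> nrm u \<le> nrm x"
    using continuous_attains_inf[of "sphere (0::real^2) 1" nrm] by (auto simp: sphere_eq_empty)
  have "nrm u \<noteq> 0" using u(1) by auto
  then have pos: "nrm u > 0" using nrm_ge_0[of u] by linarith
  show ?thesis
  proof (rule that[of "1 / nrm u"])
    show "norm x \<le> 1 / nrm u * nrm x" for x
    proof (cases "x = 0")
      case False
      then have "nrm u \<le> nrm ((1 / norm x) *\<^sub>R x)" by (intro u) simp
      also have "\<dots> = nrm x / norm x" by (simp del: nrm_scaleR add: nrm_scaleR[of "1 / norm x"])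
      finally show ?thesis using False pos by (simp add: field_simps)
    qed simp
  qed (use pos in simp)
qed

end

text \<open>Linear functionals are written as \<open>det2 v\<close>, so that a non-zero
  \<open>v\<close> spans the kernel and is the direction of the level lines, in particular of a
  side.\<close>

definition det2 :: "real ^ 2 \<Rightarrow> real ^ 2 \<Rightarrow> real" where
  "det2 x y = x $ 1 * y $ 2 - x $ 2 * y $ 1"

lemma det2_algebra:
  "det2 x (y + z) = det2 x y + det2 x z" "det2 x (y - z) = det2 x y - det2 x z"
  "det2 x (c *\<^sub>R y) = c * det2 x y" "det2 x x = 0" "det2 x 0 = 0"
  "det2 (x + y) z = det2 x z + det2 y z" "det2 (x - y) z = det2 x z - det2 y z"
  "det2 (c *\<^sub>R x) z = c * det2 x z" "det2 0 x = 0"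
  unfolding det2_def by (simp_all add: algebra_simps)

lemma det2_cramer: "det2 a b *\<^sub>R x = det2 x b *\<^sub>R a + det2 a x *\<^sub>R b"
  unfolding det2_def by (simp add: vec_eq_iff forall_2 algebra_simps)

lemma det2_coordinates:
  assumes "det2 a b \<noteq> 0"
  shows "x = (det2 x b / det2 a b) *\<^sub>R a + (det2 a x / det2 a b) *\<^sub>R b"
proof -
  have "det2 a b *\<^sub>R x = det2 a b *\<^sub>R ((det2 x b / det2 a b) *\<^sub>R a + (det2 a x / det2 a b) *\<^sub>R b)"
    using assms det2_cramer[of a b x] by (simp add: scaleR_add_right)
  then show ?thesis using assms by simp
qed

lemma det2_eq_0_imp_parallel:
  assumes "det2 v x = 0" "v \<noteq> 0"
  obtains t where "x = t *\<^sub>R v"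
proof -
  define n where "n = v $ 1 * v $ 1 + v $ 2 * v $ 2"
  have "v $ 1 \<noteq> 0 \<or> v $ 2 \<noteq> 0" using assms(2) by (auto simp: vec_eq_iff forall_2)
  then have n: "n \<noteq> 0" unfolding n_def by (simp add: sum_squares_eq_zero_iff)
  have d: "v $ 1 * x $ 2 = v $ 2 * x $ 1" using assms(1) unfolding det2_def by simp
  have "n *\<^sub>R x = (v $ 1 * x $ 1 + v $ 2 * x $ 2) *\<^sub>R v"
    unfolding n_def using d by (simp add: vec_eq_iff forall_2 algebra_simps)
  then have "x = ((v $ 1 * x $ 1 + v $ 2 * x $ 2) / n) *\<^sub>R v"
    using n by (metis (no_types, lifting) divide_inverse_commute scaleR_one scaleR_scaleR left_inverse)
  then show ?thesis by (rule that)
qed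

lemma coordinate_system_iff_det2: "coordinate_system e1 e2 \<longleftrightarrow> det2 e1 e2 \<noteq> 0"
proof -
  have "collinear {0, e1, e2} \<longleftrightarrow> det2 e1 e2 = 0"
    unfolding collinear_lemma by (metis det2_algebra(3,4,5,9) det2_eq_0_imp_parallel mult_zero_right)
  then show ?thesis unfolding coordinate_system_def by simp
qed

lemma polyhedron_det2_le: "polyhedron {x. det2 v x \<le> b}"
proof -
  have "det2 v x = vector [- v $ 2, v $ 1] \<bullet> x" for x
    unfolding det2_def by (simp add: inner_vec_def sum_2)
  then show ?thesis by (simp add: polyhedron_halfspace_le)
qed

section \<open>Supporting lines and polygonal unit balls\<close>

context normed_plane
begin

definition tangent :: "real ^ 2 \<Rightarrow> real ^ 2 \<Rightarrow> bool" where
  "tangent \<theta> v \<longleftrightarrow> nrm \<theta> = 1 \<and> (\<forall>t. 1 \<le> nrm (\<theta> + t *\<^sub>R v))"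

lemma tangent_det2_le:
  assumes "tangent \<theta> v" "v \<noteq> 0" "nrm x \<le> 1"
  shows "\<bar>det2 v x\<bar> \<le> \<bar>det2 v \<theta>\<bar>"
proof (rule ccontr)
  assume "\<not> ?thesis"
  then have less: "\<bar>det2 v \<theta>\<bar> < \<bar>det2 v x\<bar>" by simp
  \<comment> \<open>The factor \<open>r\<close> moves \<open>x\<close> onto the line through
    \<theta> in direction \<open>v\<close>; being smaller than 1 in modulus, it would bring that
    line into the open ball.\<close>
  define r where "r = det2 v \<theta> / det2 v x"
  have r: "\<bar>r\<bar> < 1" "r * det2 v x = det2 v \<theta>" using less unfolding r_def by (auto simp: abs_divide)
  have "det2 v (r *\<^sub>R x - \<theta>) = 0" by (simp add: det2_algebra r)
  then obtain t where "r *\<^sub>R x - \<theta> = t *\<^sub>R v" using assms(2) det2_eq_0_imp_parallel by blast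
  then have "\<theta> + t *\<^sub>R v = r *\<^sub>R x" by (simp add: algebra_simps)
  then have "1 \<le> nrm (r *\<^sub>R x)" using assms(1) unfolding tangent_def by metis
  moreover have "\<bar>r\<bar> * nrm x \<le> \<bar>r\<bar> * 1" using assms(3) by (intro mult_left_mono) auto
  ultimately show False using r by simp
qed

lemma tangent_det2_neq_0:
  assumes "tangent \<theta> v" "v \<noteq> 0"
  shows "det2 v \<theta> \<noteq> 0"
proof
  assume "det2 v \<theta> = 0"
  then obtain t where "\<theta> = t *\<^sub>R v" using assms(2) det2_eq_0_imp_parallel by blast
  then have "\<theta> + (- t) *\<^sub>R v = 0" by simp
  then have "1 \<le> nrm 0" using assms(1) unfolding tangent_def by metis
  then show False by simp
qed

lemma aff_dim_unit_ball: "aff_dim (unit_ball nrm) = 2"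
proof -
  obtain \<beta> where \<beta>: "\<beta> > 0" "\<And>x. nrm x \<le> \<beta> * norm x" using nrm_le_norm by blast
  have "ball 0 (1 / \<beta>) \<subseteq> unit_ball nrm"
  proof
    fix x :: "real ^ 2" assume "x \<in> ball 0 (1 / \<beta>)"
    then have "\<beta> * norm x \<le> 1" using \<beta>(1) by (simp add: field_simps)
    then show "x \<in> unit_ball nrm" using \<beta>(2)[of x] unfolding unit_ball_def by simp
  qed
  then have "interior (unit_ball nrm) \<noteq> {}"
    using \<beta>(1) interior_maximal[of "ball 0 (1 / \<beta>)" "unit_ball nrm"] by fastforce
  then show ?thesis using aff_dim_nonempty_interior[of "unit_ball nrm"] by simp
qed

text \<open>The ball is cut out by strips between parallel supporting lines. The width of a strip
  depends on its direction only, as two points with the same tangent direction bound each other; so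
  one point of tangency \<open>h v\<close> per direction suffices.\<close>

lemma finite_tangents_imp_polygon:
  assumes V: "finite V" and tan: "\<And>\<theta>. nrm \<theta> = 1 \<Longrightarrow> \<exists>v\<in>V. v \<noteq> 0 \<and> tangent \<theta> v"
  shows "convex_polygon (unit_ball nrm)"
proof -
  define V' where "V' = {v \<in> V. v \<noteq> 0 \<and> (\<exists>\<theta>. tangent \<theta> v)}"
  have "\<forall>v\<in>V'. \<exists>\<theta>. tangent \<theta> v" unfolding V'_def by blast
  then obtain h where h: "\<And>v. v \<in> V' \<Longrightarrow> tangent (h v) v" by metis
  define H where "H v = {x. det2 v x \<le> \<bar>det2 v (h v)\<bar>} \<inter> {x. det2 (- v) x \<le> \<bar>det2 v (h v)\<bar>}" for v
  have H: "x \<in> H v \<longleftrightarrow> \<bar>det2 v x\<bar> \<le> \<bar>det2 v (h v)\<bar>" for x v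
    using det2_algebra(8)[of "-1" v x] unfolding H_def by (auto simp: abs_le_iff)
  have "unit_ball nrm = \<Inter> (H ` V')"
  proof (intro equalityI subsetI)
    fix x assume "x \<in> unit_ball nrm"
    then show "x \<in> \<Inter> (H ` V')"
      using tangent_det2_le[OF h] unfolding unit_ball_def by (simp add: H V'_def)
  next
    fix x assume x: "x \<in> \<Inter> (H ` V')"
    show "x \<in> unit_ball nrm"
    proof (rule ccontr)
      assume "x \<notin> unit_ball nrm"
      then have gt: "nrm x > 1" unfolding unit_ball_def by simp
      define \<theta> where "\<theta> = (1 / nrm x) *\<^sub>R x"
      have \<theta>: "nrm \<theta> = 1" "x = nrm x *\<^sub>R \<theta>" using gt unfolding \<theta>_def by auto
      obtain v where v: "v \<in> V" "v \<noteq> 0" "tangent \<theta> v" using tan \<theta> by blast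
      then have v': "v \<in> V'" unfolding V'_def by blast
      have "\<bar>det2 v (h v)\<bar> \<le> \<bar>det2 v \<theta>\<bar>"
        using tangent_det2_le[OF v(3,2)] h[OF v'] unfolding tangent_def by simp
      moreover have "nrm x * \<bar>det2 v \<theta>\<bar> \<le> \<bar>det2 v (h v)\<bar>"
      proof -
        have "nrm x * \<bar>det2 v \<theta>\<bar> = \<bar>det2 v (nrm x *\<^sub>R \<theta>)\<bar>" by (simp add: det2_algebra abs_mult)
        also have "\<dots> = \<bar>det2 v x\<bar>" using \<theta>(2) by simp
        finally show ?thesis using x v' by (auto simp: H)
      qed
      moreover have "1 * \<bar>det2 v \<theta>\<bar> < nrm x * \<bar>det2 v \<theta>\<bar>"
        using gt tangent_det2_neq_0[OF v(3,2)] by (intro mult_strict_right_mono) auto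
      ultimately show False by simp
    qed
  qed
  moreover have "polyhedron (\<Inter> (H ` V'))"
    using V unfolding V'_def H_def by (intro polyhedron_Inter) (auto intro!: polyhedron_Int polyhedron_det2_le)
  moreover have "bounded (unit_ball nrm)"
  proof -
    obtain \<alpha> where \<alpha>: "\<alpha> > 0" "\<And>x. norm x \<le> \<alpha> * nrm x" using norm_le_nrm by blast
    have "norm x \<le> \<alpha>" if "x \<in> unit_ball nrm" for x
    proof -
      have "\<alpha> * nrm x \<le> \<alpha> * 1" using that \<alpha>(1) unfolding unit_ball_def by (intro mult_left_mono) auto
      then show ?thesis using \<alpha>(2)[of x] by simp
    qed
    then show ?thesis unfolding bounded_iff by blast
  qed
  ultimately have "polytope (unit_ball nrm)" by (simp add: polytope_eq_bounded_polyhedron)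
  then show ?thesis unfolding convex_polygon_def using aff_dim_unit_ball by simp
qed

end

section \<open>Sets with few distances\<close>

locale sparse_distances = normed_plane nrm for nrm +
  fixes S :: "(real ^ 2) set" and K :: real and C :: real and N0 :: nat
  assumes dense: "\<And>x. \<exists>y\<in>S. nrm (x - y) \<le> K"
    and sparse: "\<And>N. N \<ge> N0 \<Longrightarrow> finite (distance_set nrm N S) \<and>
      real (card (distance_set nrm N S)) \<le> C * real N"
begin

definition dists :: "real set" where
  "dists = {nrm (a - b) | a b. a \<in> S \<and> b \<in> S}"

lemma dists_memI: "a \<in> S \<Longrightarrow> b \<in> S \<Longrightarrow> nrm (a - b) \<in> dists"
  unfolding dists_def by blast

lemma distance_set_eq: "distance_set nrm N S = dists \<inter> {..real N}"
  unfolding distance_set_def dists_def by auto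

lemma K_ge_0: "K \<ge> 0"
  using dense[of 0] nrm_ge_0 order_trans by blast

lemma finite_dists: "finite (dists \<inter> {a..b})"
proof -
  define N where "N = max N0 (nat \<lceil>b\<rceil>)"
  have "b \<le> real N" unfolding N_def by linarith
  then have "dists \<inter> {a..b} \<subseteq> distance_set nrm N S" unfolding distance_set_eq by auto
  moreover have "finite (distance_set nrm N S)" using sparse[of N] unfolding N_def by simp
  ultimately show ?thesis by (rule finite_subset)
qed

lemma sparse_dists_windows:
  assumes "1 \<le> w"
  shows "\<exists>R\<ge>R0. real (card (dists \<inter> {R..R+w})) \<le> (8*\<bar>C\<bar>+1) * w \<and>
    real (card (dists \<inter> {R-x..R-x+w})) \<le> (8*\<bar>C\<bar>+1) * w"
proof (rule sparse_windows[where ?N0.0 = N0])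
  show "0 \<le> d" if "d \<in> dists" for d using that unfolding dists_def by auto
  show "finite (dists \<inter> {..real N}) \<and> real (card (dists \<inter> {..real N})) \<le> \<bar>C\<bar> * real N" if "N0 \<le> N" for N
  proof -
    have "C * real N \<le> \<bar>C\<bar> * real N" by (intro mult_right_mono) auto
    then show ?thesis using sparse[OF that] unfolding distance_set_eq by simp
  qed
qed (use assms in auto)

text \<open>Area beats length: the window holding all distances from a far point to \<open>P\<close>
  has length linear in \<open>m\<close>, so for large \<open>m\<close> it contains fewer distances
  than \<open>P\<close> has points.\<close>

lemma many_points:
  obtains c where "c \<ge> 1" "\<And>m. \<exists>P\<subseteq>S. finite P \<and> card P = m\<^sup>2 \<and> (\<forall>p\<in>P. nrm p \<le> c * (real m + 1))"
proof -
  obtain \<alpha> where \<alpha>: "\<alpha> > 0" "\<And>x. norm x \<le> \<alpha> * nrm x" using norm_le_nrm by blast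
  obtain \<beta> where \<beta>: "\<beta> > 0" "\<And>x. nrm x \<le> \<beta> * norm x" using nrm_le_norm by blast
  \<comment> \<open>Distinct grid points at spacing \<open>h\<close> are at least
    \<open>2 * K + 1\<close> apart in the norm, so points of \<open>S\<close> within
    \<open>K\<close> of them are distinct.\<close>
  define h where "h = (2 * K + 1) * \<alpha>"
  have h: "h > 0" unfolding h_def using \<alpha> K_ge_0 by simp
  define g :: "nat \<times> nat \<Rightarrow> real ^ 2" where "g z = h *\<^sub>R vector [real (fst z), real (snd z)]" for z
  have "\<forall>z. \<exists>y. y \<in> S \<and> nrm (g z - y) \<le> K" using dense by blast
  then obtain \<sigma> where \<sigma>: "\<And>z. \<sigma> z \<in> S" "\<And>z. nrm (g z - \<sigma> z) \<le> K" by metis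
  have far: "nrm (g z - g z') > 2 * K" if "z \<noteq> z'" for z z'
  proof -
    have "1 \<le> \<bar>real (fst z) - real (fst z')\<bar> \<or> 1 \<le> \<bar>real (snd z) - real (snd z')\<bar>"
      using that by (auto simp: prod_eq_iff)
    then have "h * 1 \<le> \<bar>(g z - g z') $ 1\<bar> \<or> h * 1 \<le> \<bar>(g z - g z') $ 2\<bar>"
      using h unfolding g_def by (auto simp: right_diff_distrib[symmetric] abs_mult)
    then have "h \<le> norm (g z - g z')"
      using component_le_norm_cart[of "g z - g z'" 1] component_le_norm_cart[of "g z - g z'" 2] by auto
    also have "\<dots> \<le> \<alpha> * nrm (g z - g z')" by (rule \<alpha>)
    finally have "2 * K + 1 \<le> nrm (g z - g z')" using \<alpha>(1) unfolding h_def by (simp add: mult.commute)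
    then show ?thesis by simp
  qed
  have inj: "inj \<sigma>"
  proof (rule injI, rule ccontr)
    fix z z' assume eq: "\<sigma> z = \<sigma> z'" and "z \<noteq> z'"
    have "nrm (g z - g z') \<le> nrm (g z - \<sigma> z) + nrm (\<sigma> z - g z')" by (rule nrm_triangle_diff)
    also have "\<dots> \<le> 2 * K" using \<sigma>(2)[of z] \<sigma>(2)[of z'] nrm_minus_commute[of "\<sigma> z" "g z'"] eq by simp
    finally show False using far[OF \<open>z \<noteq> z'\<close>] by simp
  qed
  define c where "c = 1 + K + 2 * \<beta> * h"
  show ?thesis
  proof (rule that[of c])
    show "c \<ge> 1" unfolding c_def using K_ge_0 \<beta>(1) h by simp
    fix m :: nat
    let ?P = "\<sigma> ` ({..<m} \<times> {..<m})"
    have "nrm (\<sigma> z) \<le> c * (real m + 1)" if z: "z \<in> {..<m} \<times> {..<m}" for z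
    proof -
      have "norm (g z) \<le> (\<Sum>i\<in>UNIV. \<bar>g z $ i\<bar>)" by (rule norm_le_l1_cart)
      also have "\<dots> = h * real (fst z) + h * real (snd z)" using h by (simp add: g_def sum_2 abs_mult)
      also have "\<dots> \<le> h * real m + h * real m" using z h by (intro add_mono mult_left_mono) auto
      finally have "\<beta> * norm (g z) \<le> \<beta> * (2 * h * real m)" using \<beta>(1) by (intro mult_left_mono) auto
      then have "nrm (\<sigma> z) \<le> 2 * \<beta> * h * real m + K"
        using \<beta>(2)[of "g z"] nrm_triangle_sub[of "\<sigma> z" "g z"] nrm_minus_commute[of "\<sigma> z" "g z"] \<sigma>(2)[of z]
        by (simp add: algebra_simps)
      also have "\<dots> \<le> c * (real m + 1)"
        using K_ge_0 h \<beta>(1) unfolding c_def by (simp add: algebra_simps)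
      finally show ?thesis .
    qed
    then show "\<exists>P\<subseteq>S. finite P \<and> card P = m\<^sup>2 \<and> (\<forall>p\<in>P. nrm p \<le> c * (real m + 1))"
      using \<sigma>(1) inj by (intro exI[of _ ?P])
        (auto simp: card_image inj_on_subset card_cartesian_product power2_eq_square)
  qed
qed

text \<open>On a line the norm is convex, and a convex function with equal values at two points is
  nowhere smaller outside the segment between them.\<close>

lemma convex_equal_imp_le:
  assumes eq: "nrm a = nrm (a + v)" and t: "1 \<le> \<bar>t\<bar>"
  shows "nrm a \<le> nrm (a + t *\<^sub>R v)"
proof -
  have ge: "nrm a \<le> nrm (a + t *\<^sub>R v)" if "nrm a = nrm (a + v)" "1 \<le> t" for a v t
  proof -
    have "t *\<^sub>R (a + v) = (t - 1) *\<^sub>R a + (a + t *\<^sub>R v)" by (simp add: algebra_simps)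
    then have "nrm (t *\<^sub>R (a + v)) \<le> nrm ((t - 1) *\<^sub>R a) + nrm (a + t *\<^sub>R v)" by (metis nrm_triangle)
    then have "t * nrm (a + v) \<le> (t - 1) * nrm a + nrm (a + t *\<^sub>R v)"
      unfolding nrm_scaleR using that by simp
    then show ?thesis unfolding that(1)[symmetric] by (simp add: algebra_simps)
  qed
  show ?thesis
  proof (cases "1 \<le> t")
    case True
    then show ?thesis using ge eq by simp
  next
    case False
    then have "1 \<le> 1 - t" using t by simp
    then have "nrm (a + v) \<le> nrm ((a + v) + (1 - t) *\<^sub>R (- v))" using eq by (intro ge) simp_all
    then show ?thesis using eq by (simp add: algebra_simps)
  qed
qed

text \<open>If \<open>P\<close> has more points than there are distances in a window, then a far away point of \<open>S\<close>
  has the same distance to two points \<open>p, q\<close> of \<open>P\<close>; letting the far point tend to infinity in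
  direction \<open>\<theta>\<close>, the direction \<open>p - q\<close> becomes tangent to the unit ball at \<open>\<theta>\<close>.\<close>

lemma tangent_to_difference:
  assumes P: "P \<subseteq> S" "finite P" "\<And>p. p \<in> P \<Longrightarrow> nrm p \<le> L"
    and L: "1 \<le> 2 * (L + K)" and card: "(8*\<bar>C\<bar>+1) * (2 * (L + K)) < real (card P)"
    and \<theta>: "nrm \<theta> = 1"
  shows "\<exists>p\<in>P. \<exists>q\<in>P. p \<noteq> q \<and> tangent \<theta> (p - q)"
proof -
  define Q where "Q R pq \<longleftrightarrow> fst pq \<noteq> snd pq \<and>
    (\<exists>y. nrm (R *\<^sub>R \<theta> - y) \<le> K \<and> nrm (y - fst pq) = nrm (y - snd pq))" for R pq
  have "\<exists>R\<ge>R0. \<exists>pq\<in>P\<times>P. Q R pq" for R0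
  proof -
    obtain R' where R': "R' \<ge> \<bar>R0\<bar>"
      "real (card (dists \<inter> {R'..R'+2*(L+K)})) \<le> (8*\<bar>C\<bar>+1) * (2*(L+K))"
      using sparse_dists_windows[OF L, of "\<bar>R0\<bar>"] by blast
    \<comment> \<open>\<open>R\<close> is the centre of the window: replacing R times \<theta> by
      \<open>y\<close> costs at most \<open>K\<close>, subtracting \<open>p\<close> at most
      \<open>L\<close>.\<close>
    define R where "R = R' + (L + K)"
    have RR: "R \<ge> R0" using R' L unfolding R_def by simp
    obtain y where y: "y \<in> S" "nrm (R *\<^sub>R \<theta> - y) \<le> K" using dense by blast
    have R0: "R \<ge> 0" using R' L unfolding R_def by simp
    have "(\<lambda>p. nrm (y - p)) ` P \<subseteq> dists \<inter> {R'..R'+2*(L+K)}"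
    proof
      fix d assume "d \<in> (\<lambda>p. nrm (y - p)) ` P"
      then obtain p where p: "p \<in> P" "d = nrm (y - p)" by blast
      have "nrm (R *\<^sub>R \<theta>) = R" using \<theta> R0 by simp
      moreover have "nrm (R *\<^sub>R \<theta>) \<le> nrm y + nrm (R *\<^sub>R \<theta> - y)" by (rule nrm_triangle_sub)
      moreover have "nrm y \<le> nrm (R *\<^sub>R \<theta>) + nrm (R *\<^sub>R \<theta> - y)"
        using nrm_triangle_sub[of y "R *\<^sub>R \<theta>"] nrm_minus_commute by metis
      moreover have "nrm y \<le> nrm p + d" "d \<le> nrm y + nrm p"
        using nrm_triangle_sub[of y p] nrm_triangle[of y "- p"] p by auto
      ultimately show "d \<in> dists \<inter> {R'..R'+2*(L+K)}"
        using y P(3)[OF p(1)] p P(1) dists_memI[of y p] unfolding R_def by auto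
    qed
    then have "card ((\<lambda>p. nrm (y - p)) ` P) \<le> card (dists \<inter> {R'..R'+2*(L+K)})"
      by (rule card_mono[OF finite_dists])
    then have "card ((\<lambda>p. nrm (y - p)) ` P) < card P" using R'(2) card by linarith
    then have "\<not> inj_on (\<lambda>p. nrm (y - p)) P" by (rule pigeonhole)
    then obtain p q where "p \<in> P" "q \<in> P" "p \<noteq> q" "nrm (y - p) = nrm (y - q)"
      unfolding inj_on_def by blast
    then have "Q R (p, q)" "(p, q) \<in> P \<times> P" unfolding Q_def using y by auto
    then show ?thesis using RR by blast
  qed
  \<comment> \<open>The pair found depends on \<open>R\<close>; there are finitely many pairs, so
    one of them serves arbitrarily large \<open>R\<close>.\<close>
  then have "\<exists>\<^sub>F R in at_top. \<exists>pq\<in>P\<times>P. Q R pq"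
    unfolding frequently_def eventually_at_top_linorder by meson
  then have "\<exists>pq\<in>P\<times>P. \<exists>\<^sub>F R in at_top. Q R pq"
    using P(2) by (intro frequently_bex_finite) auto
  then obtain p q where pq: "p \<in> P" "q \<in> P" and freq: "\<exists>\<^sub>F R in at_top. Q R (p, q)" by auto
  have ex: "\<exists>R\<ge>R0. Q R (p, q)" for R0
    using freq unfolding frequently_def eventually_at_top_linorder by blast
  have "p \<noteq> q" using ex[of 0] unfolding Q_def by auto
  moreover have "1 \<le> nrm (\<theta> + t *\<^sub>R (p - q))" for t
  proof (cases "t = 0")
    case False
    show ?thesis
    proof (rule ccontr)
      assume "\<not> ?thesis"
      then have less: "nrm (\<theta> + t *\<^sub>R (p - q)) < 1" by simp
      define M where "M = K + nrm p"
      have M: "M \<ge> 0" unfolding M_def using K_ge_0 by simp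
      \<comment> \<open>The first bound yields \<open>R * \<bar>t\<bar> \<ge> 1\<close>, needed for
        convexity; the second makes the drop of the norm along the line exceed two errors of size
        \<open>M\<close>.\<close>
      obtain R where R: "R \<ge> max (1 / \<bar>t\<bar>) (2 * M / (1 - nrm (\<theta> + t *\<^sub>R (p - q))) + 1)" "Q R (p, q)"
        using ex by blast
      have R1: "1 / \<bar>t\<bar> \<le> R" and R2: "2 * M / (1 - nrm (\<theta> + t *\<^sub>R (p - q))) < R" using R(1) by auto
      have "R * \<bar>t\<bar> \<ge> 1" using R1 False by (simp add: field_simps)
      have R0: "R > 0" using R1 False by (smt (verit) zero_less_abs_iff zero_less_divide_1_iff)
      obtain y where y: "nrm (R *\<^sub>R \<theta> - y) \<le> K" "nrm (y - p) = nrm (y - q)" using R(2) unfolding Q_def by auto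
      define a where "a = y - p"
      have a: "nrm (R *\<^sub>R \<theta> - a) \<le> M"
        using nrm_triangle[of "R *\<^sub>R \<theta> - y" p] y(1) unfolding a_def M_def by (simp add: algebra_simps)
      have "nrm a = nrm (a + (p - q))" using y(2) unfolding a_def by simp
      then have "nrm a \<le> nrm (a + (R * t) *\<^sub>R (p - q))"
        using \<open>R * \<bar>t\<bar> \<ge> 1\<close> R0 by (intro convex_equal_imp_le) (auto simp: abs_mult)
      moreover have "nrm (a + (R * t) *\<^sub>R (p - q)) \<le> nrm (R *\<^sub>R (\<theta> + t *\<^sub>R (p - q))) + nrm (R *\<^sub>R \<theta> - a)"
        using nrm_triangle_sub[of "a + (R * t) *\<^sub>R (p - q)" "R *\<^sub>R (\<theta> + t *\<^sub>R (p - q))"]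
          nrm_minus_commute[of a "R *\<^sub>R \<theta>"] by (simp add: algebra_simps)
      moreover have "R \<le> nrm a + nrm (R *\<^sub>R \<theta> - a)" using nrm_triangle_sub[of "R *\<^sub>R \<theta>" a] \<theta> R0 by simp
      moreover have "nrm (R *\<^sub>R (\<theta> + t *\<^sub>R (p - q))) = R * nrm (\<theta> + t *\<^sub>R (p - q))"
        using R0 by (simp del: scaleR_add_right)
      ultimately have "R * (1 - nrm (\<theta> + t *\<^sub>R (p - q))) \<le> 2 * M" using a by (simp add: algebra_simps)
      moreover have "2 * M < R * (1 - nrm (\<theta> + t *\<^sub>R (p - q)))" using R2 less by (simp add: pos_divide_less_eq)
      ultimately show False by simp
    qed
  qed (simp add: \<theta>)
  ultimately show ?thesis using pq \<theta> unfolding tangent_def by blast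
qed

lemma polygon: "convex_polygon (unit_ball nrm)"
proof -
  obtain c where c: "c \<ge> 1" "\<And>m. \<exists>P\<subseteq>S. finite P \<and> card P = m\<^sup>2 \<and> (\<forall>p\<in>P. nrm p \<le> c * (real m + 1))"
    using many_points by blast
  \<comment> \<open>For \<open>L = c * (m + 1)\<close> with positive \<open>m\<close> the window
    admits at most \<open>d * m\<close> distances, against \<open>m * m\<close> points.\<close>
  define d where "d = (8*\<bar>C\<bar>+1) * (2 * (2 * c + K))"
  have cK: "0 \<le> c" "0 \<le> K" using c K_ge_0 by auto
  obtain m :: nat where m: "d + 1 < real m" using reals_Archimedean2 by blast
  have d0: "d \<ge> 0" unfolding d_def using cK by (intro mult_nonneg_nonneg) auto
  obtain P where P: "P \<subseteq> S" "finite P" "card P = m\<^sup>2" "\<forall>p\<in>P. nrm p \<le> c * (real m + 1)" using c(2) by blast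
  define L where "L = c * (real m + 1)"
  have "1 * 1 \<le> L" unfolding L_def using c by (intro mult_mono) auto
  then have L: "1 \<le> 2 * (L + K)" using cK by simp
  have "2 * (L + K) \<le> 2 * (2 * c + K) * real m"
  proof -
    have "c * 1 \<le> c * real m" "K * 1 \<le> K * real m" using cK m d0 by (intro mult_left_mono; linarith)+
    then show ?thesis unfolding L_def by (simp add: algebra_simps)
  qed
  then have "(8*\<bar>C\<bar>+1) * (2 * (L + K)) \<le> (8*\<bar>C\<bar>+1) * (2 * (2 * c + K) * real m)"
    by (intro mult_left_mono) auto
  also have "\<dots> = d * real m" unfolding d_def by simp
  also have "\<dots> < real m * real m" using m d0 by (intro mult_strict_right_mono) auto
  also have "\<dots> = real (card P)" using P by (simp add: power2_eq_square)
  finally have card: "(8*\<bar>C\<bar>+1) * (2 * (L + K)) < real (card P)" .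
  show ?thesis
  proof (rule finite_tangents_imp_polygon)
    show "finite ((\<lambda>(p, q). p - q) ` (P \<times> P))" using P by simp
    fix \<theta> assume \<theta>: "nrm \<theta> = 1"
    obtain p q where "p \<in> P" "q \<in> P" "p \<noteq> q" "tangent \<theta> (p - q)"
      using tangent_to_difference[OF P(1,2) _ L card \<theta>] P(4) unfolding L_def by blast
    then show "\<exists>v\<in>(\<lambda>(p, q). p - q) ` (P \<times> P). v \<noteq> 0 \<and> tangent \<theta> v"
      by (intro bexI[of _ "p - q"]) force+
  qed
qed

text \<open>Captures the functional of a side without mentioning faces: the norm agrees with
  \<open>f\<close> near a unit vector, hence by homogeneity on an open cone.\<close>

definition supports :: "(real ^ 2 \<Rightarrow> real) \<Rightarrow> bool" where
  "supports f \<longleftrightarrow> linear f \<and> (\<forall>x. \<bar>f x\<bar> \<le> nrm x) \<and>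
     (\<exists>\<theta> \<epsilon>. \<epsilon> > 0 \<and> nrm \<theta> = 1 \<and> (\<forall>x. nrm (x - \<theta>) \<le> \<epsilon> \<longrightarrow> nrm x = f x))"

lemma supports_relatively_dense:
  assumes "supports f"
  shows "relatively_dense (f ` S)"
proof -
  obtain \<theta> \<epsilon> where \<theta>: "\<epsilon> > 0" "nrm \<theta> = 1" "\<And>x. nrm (x - \<theta>) \<le> \<epsilon> \<Longrightarrow> nrm x = f x"
    using assms unfolding supports_def by blast
  interpret f: linear f using assms unfolding supports_def by simp
  have le: "\<bar>f x\<bar> \<le> nrm x" for x using assms unfolding supports_def by blast
  have "f \<theta> = 1" using \<theta>(3)[of \<theta>] \<theta> by simp
  have "\<exists>a\<in>f ` S. \<bar>x - a\<bar> \<le> K" for x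
  proof -
    obtain y where y: "y \<in> S" "nrm (x *\<^sub>R \<theta> - y) \<le> K" using dense by blast
    have "f (x *\<^sub>R \<theta> - y) = x - f y" by (simp add: f.diff f.scale \<open>f \<theta> = 1\<close>)
    then have "\<bar>x - f y\<bar> \<le> K" using le[of "x *\<^sub>R \<theta> - y"] y by simp
    then show ?thesis using y by blast
  qed
  then show ?thesis unfolding relatively_dense_def by blast
qed

text \<open>A difference \<open>f p - f q\<close> is also the difference of the two distances \<open>f (y - q)\<close> and \<open>f (y - p)\<close>,
  where \<open>y\<close> is a far away point in the cone on which the norm is \<open>f\<close>; both distances can be
  placed in windows containing boundedly many distances.\<close>

lemma supports_uniformly_locally_finite:
  assumes "supports f"
  shows "uniformly_locally_finite (differences (f ` S))"
  unfolding uniformly_locally_finite_def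
proof
  obtain \<theta> \<epsilon> where \<theta>: "\<epsilon> > 0" "nrm \<theta> = 1" "\<And>x. nrm (x - \<theta>) \<le> \<epsilon> \<Longrightarrow> nrm x = f x"
    using assms unfolding supports_def by blast
  interpret f: linear f using assms unfolding supports_def by simp
  have le: "\<bar>f x\<bar> \<le> nrm x" for x using assms unfolding supports_def by blast
  have f\<theta>: "f \<theta> = 1" using \<theta>(3)[of \<theta>] \<theta> by simp
  have cone: "nrm x = f x" if "nrm (x - r *\<^sub>R \<theta>) \<le> \<epsilon> * r" "r > 0" for x r
  proof -
    have "nrm ((1 / r) *\<^sub>R x - \<theta>) = nrm ((1 / r) *\<^sub>R (x - r *\<^sub>R \<theta>))" using that by (simp add: algebra_simps)
    also have "\<dots> = nrm (x - r *\<^sub>R \<theta>) / r" using that by (simp del: scaleR_diff_right)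
    also have "\<dots> \<le> \<epsilon>" using that by (simp add: divide_le_eq)
    finally have "nrm ((1 / r) *\<^sub>R x) = f ((1 / r) *\<^sub>R x)" by (rule \<theta>)
    then show ?thesis using that by (simp add: f.scale)
  qed
  fix w :: real
  \<comment> \<open>The height of \<open>y d - q d\<close> is known up to \<open>2 * K\<close>, and
    \<open>d\<close> up to \<open>\<bar>w\<bar>\<close>; the 1 ensures that the windows have length
    at least 1.\<close>
  define W where "W = \<bar>w\<bar> + 2 * K + 1"
  have W: "1 \<le> W" unfolding W_def using K_ge_0 by simp
  define n where "n = nat \<lfloor>(8*\<bar>C\<bar>+1) * W\<rfloor>"
  have n: "k \<le> n" if "real k \<le> (8*\<bar>C\<bar>+1) * W" for k using that unfolding n_def by linarith
  show "\<exists>c. \<forall>x. finite (differences (f ` S) \<inter> {x..x+w}) \<and> card (differences (f ` S) \<inter> {x..x+w}) \<le> c"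
  proof (rule exI[of _ "n * n"], rule allI, rule finite_if_finite_subsets_card_bdd)
    \<comment> \<open>Finiteness is not known in advance, so finite subsets are bounded. A finite
      \<open>T\<close> also has a common bound \<open>L\<close> for the chosen representatives, on
      which \<open>R\<close> may depend.\<close>
    fix x T assume T: "T \<subseteq> differences (f ` S) \<inter> {x..x+w}" "finite T"
    have "\<forall>d\<in>T. \<exists>p q. p \<in> S \<and> q \<in> S \<and> d = f p - f q" using T unfolding differences_def by blast
    then obtain p q where pq: "\<And>d. d \<in> T \<Longrightarrow> p d \<in> S" "\<And>d. d \<in> T \<Longrightarrow> q d \<in> S" "\<And>d. d \<in> T \<Longrightarrow> d = f (p d) - f (q d)"
      by metis
    define L where "L = Max (insert 0 ((\<lambda>d. nrm (p d - q d)) ` T))"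
    have L: "nrm (p d - q d) \<le> L" if "d \<in> T" for d unfolding L_def using that T by (intro Max_ge) auto
    have L0: "0 \<le> L" unfolding L_def using T by (intro Max_ge) auto
    \<comment> \<open>Beyond this bound both \<open>y d - q d\<close> and \<open>y d - p d\<close>
      lie in the cone. The two distances differ by about \<open>x\<close>, so sparse windows at a
      prescribed offset are required.\<close>
    obtain R where R: "R \<ge> (K + L) / \<epsilon> + 1"
      "real (card (dists \<inter> {R..R+W})) \<le> (8*\<bar>C\<bar>+1) * W"
      "real (card (dists \<inter> {R-(x+\<bar>w\<bar>)..R-(x+\<bar>w\<bar>)+W})) \<le> (8*\<bar>C\<bar>+1) * W"
      using sparse_dists_windows[OF W] by blast
    let ?W1 = "dists \<inter> {R..R+W}" and ?W2 = "dists \<inter> {R-(x+\<bar>w\<bar>)..R-(x+\<bar>w\<bar>)+W}"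
    have RK: "R + K > 0" "K + L \<le> \<epsilon> * (R + K)"
    proof -
      have "(K + L) / \<epsilon> \<ge> 0" using K_ge_0 L0 \<theta>(1) by simp
      then show "R + K > 0" using R(1) K_ge_0 by linarith
      have "(K + L) / \<epsilon> \<le> R + K" using R(1) K_ge_0 by linarith
      then show "K + L \<le> \<epsilon> * (R + K)" using \<theta>(1) by (simp add: divide_le_eq mult.commute)
    qed
    have "\<forall>d. \<exists>y\<in>S. nrm (q d + (R + K) *\<^sub>R \<theta> - y) \<le> K" using dense by blast
    then obtain y where y: "\<And>d. y d \<in> S" "\<And>d. nrm (q d + (R + K) *\<^sub>R \<theta> - y d) \<le> K" by metis
    have near: "nrm (y d - q d - (R + K) *\<^sub>R \<theta>) \<le> K" for d
      using y(2)[of d] nrm_minus_commute[of "q d + (R + K) *\<^sub>R \<theta>" "y d"] by (simp add: algebra_simps)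
    have fq: "nrm (y d - q d) = f (y d - q d)" for d
      using near[of d] RK L0 by (intro cone[of _ "R + K"]) auto
    have fp: "nrm (y d - p d) = f (y d - p d)" if "d \<in> T" for d
    proof (rule cone[of _ "R + K"])
      have "nrm (y d - p d - (R + K) *\<^sub>R \<theta>) \<le> nrm (y d - q d - (R + K) *\<^sub>R \<theta>) + nrm (p d - q d)"
        using nrm_triangle[of "y d - q d - (R + K) *\<^sub>R \<theta>" "- (p d - q d)"] by (simp add: algebra_simps nrm_minus_commute)
      then show "nrm (y d - p d - (R + K) *\<^sub>R \<theta>) \<le> \<epsilon> * (R + K)" using near[of d] L[OF that] RK by linarith
    qed (rule RK)
    have height: "R \<le> f (y d - q d) \<and> f (y d - q d) \<le> R + 2 * K" for d
    proof -
      have "\<bar>f (y d - q d - (R + K) *\<^sub>R \<theta>)\<bar> \<le> K" using le near order_trans by blast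
      moreover have "f (y d - q d - (R + K) *\<^sub>R \<theta>) = f (y d - q d) - (R + K)"
        by (simp add: f.diff f.scale f\<theta>)
      ultimately show ?thesis by (simp add: abs_le_iff)
    qed
    have dd: "f (y d - q d) - f (y d - p d) = d" if "d \<in> T" for d using pq(3)[OF that] by (simp add: f.diff)
    let ?g = "\<lambda>d. (nrm (y d - q d), nrm (y d - p d))"
    have "inj_on ?g T" by (rule inj_on_inverseI[of _ "\<lambda>(a, b). a - b"]) (simp add: fq fp dd)
    moreover have "?g ` T \<subseteq> ?W1 \<times> ?W2"
    proof
      fix z assume "z \<in> ?g ` T"
      then obtain d where d: "d \<in> T" "z = ?g d" by blast
      have xd: "x \<le> d" "d \<le> x + w" using T d by auto
      have "R \<le> nrm (y d - q d)" "nrm (y d - q d) \<le> R + W"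
        "R - (x + \<bar>w\<bar>) \<le> nrm (y d - p d)" "nrm (y d - p d) \<le> R - (x + \<bar>w\<bar>) + W"
        unfolding W_def fq fp[OF d(1)] using height[of d] dd[OF d(1)] xd K_ge_0 by linarith+
      moreover have "nrm (y d - q d) \<in> dists" "nrm (y d - p d) \<in> dists"
        using dists_memI y(1) pq(1,2)[OF d(1)] by blast+
      ultimately show "z \<in> ?W1 \<times> ?W2" unfolding d(2) by simp
    qed
    ultimately have "card T \<le> card (?W1 \<times> ?W2)"
      by (rule card_inj_on_le) (intro finite_cartesian_product finite_dists)
    also have "\<dots> = card ?W1 * card ?W2" by (rule card_cartesian_product)
    also have "\<dots> \<le> n * n" using n[OF R(2)] n[OF R(3)] by (rule mult_le_mono)
    finally show "card T \<le> n * n" .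
  qed
qed

end

section \<open>Sides of the unit ball\<close>

lemma linear_eq_det2:
  assumes "linear (f :: real ^ 2 \<Rightarrow> real)"
  obtains v where "f = det2 v"
proof -
  interpret linear f by fact
  have "f x = det2 (vector [f (axis 2 1), - f (axis 1 1)]) x" for x
  proof -
    have "x = (x $ 1) *\<^sub>R axis 1 1 + (x $ 2) *\<^sub>R axis 2 1"
      by (simp add: vec_eq_iff forall_2 axis_def)
    then have "f x = (x $ 1) * f (axis 1 1) + (x $ 2) * f (axis 2 1)"
      by (metis add scale real_scaleR_def)
    then show ?thesis by (simp add: det2_def)
  qed
  then show ?thesis by (intro that ext)
qed

lemma linear_det2: "linear (det2 v)"
  by (rule linearI) (simp_all add: det2_algebra)

lemma det2_swap: "det2 x y = - det2 y x"
  unfolding det2_def by simp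

lemma abs_det2_le: "\<bar>det2 x y\<bar> \<le> 2 * norm x * norm y"
proof -
  have "\<bar>det2 x y\<bar> \<le> \<bar>x $ 1\<bar> * \<bar>y $ 2\<bar> + \<bar>x $ 2\<bar> * \<bar>y $ 1\<bar>"
    unfolding det2_def using abs_triangle_ineq4[of "x $ 1 * y $ 2" "x $ 2 * y $ 1"] by (simp add: abs_mult)
  also have "\<dots> \<le> norm x * norm y + norm x * norm y"
    by (intro add_mono mult_mono component_le_norm_cart) auto
  finally show ?thesis by simp
qed

context normed_plane
begin

text \<open>Faces of a polytope are exposed, so a line cuts out the side; after scaling its equation
  to value 1, symmetry of the ball gives the bound on the absolute value.\<close>

lemma edge_functional:
  assumes poly: "convex_polygon (unit_ball nrm)" and I: "I edge_of unit_ball nrm"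
  obtains v p q where "\<And>x. \<bar>det2 v x\<bar> \<le> nrm x" "\<And>x. x \<in> I \<Longrightarrow> det2 v x = 1"
    "p \<in> I" "q \<in> I" "p \<noteq> q" "I \<subseteq> unit_ball nrm"
proof -
  have "polyhedron (unit_ball nrm)"
    using poly unfolding convex_polygon_def by (simp add: polytope_imp_polyhedron)
  then have "I exposed_face_of unit_ball nrm"
    using I exposed_face_of_polyhedron unfolding edge_of_def by blast
  then obtain a b where ab: "unit_ball nrm \<subseteq> {x. a \<bullet> x \<le> b}" "I = unit_ball nrm \<inter> {x. a \<bullet> x = b}"
    unfolding exposed_face_of_def by blast
  have "0 \<in> unit_ball nrm" unfolding unit_ball_def by simp
  then have "b \<ge> 0" using ab(1) by force
  moreover have "b \<noteq> 0"
  proof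
    \<comment> \<open>By symmetry a supporting line through the origin would contain the whole ball,
      which is two-dimensional.\<close>
    assume "b = 0"
    have "a \<bullet> x = 0" if "x \<in> unit_ball nrm" for x
    proof -
      have "- x \<in> unit_ball nrm" using that unfolding unit_ball_def by simp
      then have "a \<bullet> x \<le> 0" "a \<bullet> (- x) \<le> 0" using that ab(1) \<open>b = 0\<close> by blast+
      then show ?thesis by simp
    qed
    then have "I = unit_ball nrm" using ab(2) \<open>b = 0\<close> by auto
    then show False using I aff_dim_unit_ball unfolding edge_of_def by simp
  qed
  ultimately have b: "b > 0" by simp
  have "linear (\<lambda>x. (a \<bullet> x) / b)"
    by (rule linearI) (simp_all add: inner_add_right add_divide_distrib)
  then obtain v where v: "(\<lambda>x. (a \<bullet> x) / b) = det2 v" by (rule linear_eq_det2)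
  have le: "det2 v x \<le> nrm x" for x
  proof (cases "x = 0")
    case False
    then have pos: "nrm x > 0" using nrm_ge_0[of x] by (simp add: less_le)
    then have "(1 / nrm x) *\<^sub>R x \<in> unit_ball nrm" unfolding unit_ball_def by simp
    then have "a \<bullet> ((1 / nrm x) *\<^sub>R x) \<le> b" using ab(1) by blast
    then have "a \<bullet> x \<le> b * nrm x" using pos by (simp add: divide_le_eq)
    then have "(a \<bullet> x) / b \<le> nrm x" using b by (simp add: divide_le_eq mult.commute)
    then show ?thesis using fun_cong[OF v, of x] by simp
  qed (simp add: det2_algebra)
  have abs_le: "\<bar>det2 v x\<bar> \<le> nrm x" for x
    using le[of x] le[of "- x"] det2_algebra(3)[of v "-1" x] by (simp add: abs_le_iff)
  have one: "det2 v x = 1" if "x \<in> I" for x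
    using that ab(2) b unfolding v[symmetric] by simp
  have dim: "aff_dim I = 1" using I unfolding edge_of_def by simp
  then have "I \<noteq> {}" by auto
  then obtain p where p: "p \<in> I" by blast
  have "I \<noteq> {p}" using dim by auto
  then obtain q where "q \<in> I" "p \<noteq> q" using p by blast
  with p abs_le one ab(2) show ?thesis by (intro that[of v p q]) auto
qed

lemma slope_edge:
  assumes cs: "coordinate_system e1 e2" and I: "p \<in> I" "q \<in> I" "p \<noteq> q"
    and v: "\<And>x. x \<in> I \<Longrightarrow> det2 v x = 1"
  shows "slope e1 e2 I = (if det2 v e2 = 0 then \<infinity> else ereal (- det2 v e1 / det2 v e2))"
proof (rule slope_eqI[OF cs I])
  have d: "det2 e1 e2 \<noteq> 0" using cs coordinate_system_iff_det2 by blast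
  have rep: "\<exists>x1 x2. x = x1 *\<^sub>R e1 + x2 *\<^sub>R e2" for x
    using det2_coordinates[OF d] by blast
  obtain x1 x2 where "p = x1 *\<^sub>R e1 + x2 *\<^sub>R e2" using rep by blast
  then have "1 = x1 * det2 v e1 + x2 * det2 v e2" using v[OF I(1)] by (simp add: det2_algebra)
  then show "(det2 v e1, det2 v e2) \<noteq> (0, 0)" by auto
  show "I \<subseteq> coord_line e1 e2 (det2 v e1) (det2 v e2) (- 1)"
  proof
    fix x assume "x \<in> I"
    then have "det2 v x = 1" by (rule v)
    moreover obtain x1 x2 where x: "x = x1 *\<^sub>R e1 + x2 *\<^sub>R e2" using rep by blast
    ultimately have "det2 v e1 * x1 + det2 v e2 * x2 + (- 1) = 0" by (simp add: det2_algebra mult.commute)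
    with x show "x \<in> coord_line e1 e2 (det2 v e1) (det2 v e2) (- 1)" unfolding coord_line_def by blast
  qed
qed

text \<open>Near the midpoint both coefficients in x = a p + b q stay close to 1/2, hence
  non-negative, and the triangle inequality bounds the norm by a + b, which is the value of the
  functional.\<close>

lemma norm_eq_det2_near_midpoint:
  assumes le: "\<And>x. \<bar>det2 v x\<bar> \<le> nrm x" and v: "det2 v p = 1" "det2 v q = 1"
    and pq: "p \<noteq> q" "nrm p \<le> 1" "nrm q \<le> 1"
  shows "\<exists>\<theta> \<epsilon>. \<epsilon> > 0 \<and> nrm \<theta> = 1 \<and> (\<forall>x. nrm (x - \<theta>) \<le> \<epsilon> \<longrightarrow> nrm x = det2 v x)"
proof -
  have d: "det2 p q \<noteq> 0"
  proof
    assume "det2 p q = 0"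
    moreover have "p \<noteq> 0" using v by (auto simp: det2_algebra)
    ultimately obtain t where t: "q = t *\<^sub>R p" using det2_eq_0_imp_parallel by blast
    then have "t = 1" using v by (simp add: det2_algebra)
    with t pq show False by simp
  qed
  obtain \<alpha> where \<alpha>: "\<alpha> > 0" "\<And>x. norm x \<le> \<alpha> * nrm x" using norm_le_nrm by blast
  define \<theta> where "\<theta> = (1 / 2) *\<^sub>R (p + q)"
  \<comment> \<open>\<open>c\<close> bounds the numerators of both coefficients in terms of
    \<open>nrm\<close>, so that \<epsilon> moves each coefficient by at most 1/2; the 1 keeps
    \<open>c\<close> positive.\<close>
  define c where "c = 2 * \<alpha> * (norm p + norm q) + 1"
  have c: "c > 0" unfolding c_def using \<alpha>(1) by (intro add_nonneg_pos mult_nonneg_nonneg) auto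
  define \<epsilon> where "\<epsilon> = \<bar>det2 p q\<bar> / (2 * c)"
  have \<epsilon>0: "\<epsilon> \<ge> 0" unfolding \<epsilon>_def using c by simp
  have small: "\<bar>det2 z q\<bar> \<le> \<bar>det2 p q\<bar> / 2" "\<bar>det2 p z\<bar> \<le> \<bar>det2 p q\<bar> / 2" if z: "nrm z \<le> \<epsilon>" for z
  proof -
    have "norm z \<le> \<alpha> * \<epsilon>" using \<alpha>(2)[of z] z \<alpha>(1) by (meson mult_left_mono order_trans less_imp_le)
    then have "2 * (norm p + norm q) * norm z \<le> 2 * (norm p + norm q) * (\<alpha> * \<epsilon>)"
      by (intro mult_left_mono) auto
    also have "\<dots> = (c - 1) * \<epsilon>" unfolding c_def by simp
    also have "\<dots> \<le> c * \<epsilon>" using \<epsilon>0 by (simp add: left_diff_distrib)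
    also have "\<dots> = \<bar>det2 p q\<bar> / 2" unfolding \<epsilon>_def using c by simp
    finally have "2 * norm z * norm q + 2 * norm p * norm z \<le> \<bar>det2 p q\<bar> / 2" by (simp add: algebra_simps)
    moreover have "0 \<le> 2 * norm z * norm q" "0 \<le> 2 * norm p * norm z" by simp_all
    ultimately show "\<bar>det2 z q\<bar> \<le> \<bar>det2 p q\<bar> / 2" "\<bar>det2 p z\<bar> \<le> \<bar>det2 p q\<bar> / 2"
      using abs_det2_le[of z q] abs_det2_le[of p z] by linarith+
  qed
  have key: "nrm x = det2 v x" if x: "nrm (x - \<theta>) \<le> \<epsilon>" for x
  proof -
    define a where "a = det2 x q / det2 p q"
    define b where "b = det2 p x / det2 p q"
    have "det2 x q = det2 (x - \<theta>) q + det2 p q / 2" "det2 p x = det2 p (x - \<theta>) + det2 p q / 2"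
      unfolding \<theta>_def by (simp_all add: det2_algebra)
    then have ab: "a = det2 (x - \<theta>) q / det2 p q + 1 / 2" "b = det2 p (x - \<theta>) / det2 p q + 1 / 2"
      unfolding a_def b_def using d by (simp_all add: field_simps)
    have "\<bar>det2 (x - \<theta>) q / det2 p q\<bar> \<le> 1 / 2" "\<bar>det2 p (x - \<theta>) / det2 p q\<bar> \<le> 1 / 2"
      using small[OF x] d by (simp_all add: abs_divide divide_le_eq)
    then have pos: "a \<ge> 0" "b \<ge> 0" unfolding ab by linarith+
    have xab: "x = a *\<^sub>R p + b *\<^sub>R q" unfolding a_def b_def by (rule det2_coordinates[OF d])
    have "nrm x \<le> a * nrm p + b * nrm q"
      unfolding xab using nrm_triangle[of "a *\<^sub>R p" "b *\<^sub>R q"] pos by simp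
    also have "\<dots> \<le> a * 1 + b * 1" using pos pq by (intro add_mono mult_left_mono) auto
    also have "\<dots> = det2 v x" unfolding xab by (simp add: det2_algebra v)
    finally show ?thesis using le[of x] by simp
  qed
  have \<epsilon>: "\<epsilon> > 0" unfolding \<epsilon>_def using d c by simp
  moreover have "nrm \<theta> = 1"
    using key[of \<theta>] \<epsilon> unfolding \<theta>_def by (simp add: det2_algebra v del: nrm_scaleR)
  ultimately show ?thesis using key by blast
qed

end

lemma Q_span_scale_image:
  assumes "x \<in> Q.span F"
  shows "c * x \<in> Q.span ((*) c ` F)"
  using assms
proof (induction rule: Q.span_induct_alt)
  case base
  then show ?case by (simp add: Q.span_zero)
next
  case (step q x y)
  have "c * (of_rat q * x + y) = of_rat q * (c * x) + c * y" by (simp add: algebra_simps)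
  moreover have "c * x \<in> Q.span ((*) c ` F)" using step(1) by (intro Q.span_base imageI)
  ultimately show ?case using step(2) by (simp add: Q.span_add Q.span_scale)
qed

lemma has_asymptotic_slopes_scale:
  assumes G: "has_asymptotic_slopes G" and c: "c \<noteq> 0"
  shows "has_asymptotic_slopes ((*) c ` G)"
  unfolding has_asymptotic_slopes_def
proof (intro allI impI)
  fix f :: "real \<Rightarrow> real" assume "Modules.additive f"
  then have "Modules.additive (\<lambda>x. f (c * x))" by (rule additive_mult_left)
  then obtain s where "asymptotic_slope G (\<lambda>x. f (c * x)) s"
    using G unfolding has_asymptotic_slopes_def by blast
  then obtain C where C: "\<And>x. x \<in> G \<Longrightarrow> \<bar>f (c * x) - s * x\<bar> \<le> C" unfolding asymptotic_slope_def by blast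
  have "asymptotic_slope ((*) c ` G) f (s / c)"
    unfolding asymptotic_slope_def using C c by (intro exI[of _ C]) auto
  then show "\<exists>s. asymptotic_slope ((*) c ` G) f s" by blast
qed

section \<open>Algebraicity of the slopes of the sides\<close>

context sparse_distances
begin

lemma supports_has_asymptotic_slopes:
  assumes "supports (det2 v)" "c \<noteq> 0"
  shows "has_asymptotic_slopes ((\<lambda>z. c * det2 v z) ` differences S)"
proof -
  have "has_asymptotic_slopes (differences (det2 v ` S))"
    unfolding has_asymptotic_slopes_def
    using additive_nearly_linear_on_differences supports_relatively_dense[OF assms(1)]
      supports_uniformly_locally_finite[OF assms(1)] by blast
  moreover have "differences (det2 v ` S) = det2 v ` differences S"
  proof (intro set_eqI)
    fix x
    have "x \<in> differences (det2 v ` S) \<longleftrightarrow> (\<exists>a\<in>S. \<exists>b\<in>S. x = det2 v a - det2 v b)"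
      unfolding differences_def by blast
    also have "\<dots> \<longleftrightarrow> x \<in> det2 v ` differences S"
      unfolding differences_def det2_algebra(2)[symmetric] by blast
    finally show "x \<in> differences (det2 v ` S) \<longleftrightarrow> x \<in> det2 v ` differences S" .
  qed
  ultimately have "has_asymptotic_slopes ((*) c ` det2 v ` differences S)"
    using has_asymptotic_slopes_scale assms(2) by simp
  then show ?thesis by (simp add: image_image)
qed

text \<open>In the basis \<open>u1\<close>, \<open>u2\<close>, taken from the kernels of
  \<open>v2\<close> and \<open>v1\<close>, the four functionals are up to scaling x, y, x + y and x
  + t y, where \<open>t\<close> is the ratio in question.\<close>

lemma algebraic_ratio:
  assumes sup: "supports (det2 v1)" "supports (det2 v2)" "supports (det2 v3)" "supports (det2 v4)"
    and u: "det2 v2 u1 = 0" "det2 v1 u2 = 0" "det2 v3 u1 = 1" "det2 v3 u2 = 1" "det2 v4 u1 \<noteq> 0"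
    and v12: "det2 v1 u1 \<noteq> 0" "det2 v2 u2 \<noteq> 0" and basis: "det2 u1 u2 \<noteq> 0"
  shows "algebraic (det2 v4 u2 / det2 v4 u1)"
proof -
  define X where "X z = det2 v1 z / det2 v1 u1" for z
  define Y where "Y z = det2 v2 z / det2 v2 u2" for z
  have XY: "z = X z *\<^sub>R u1 + Y z *\<^sub>R u2" for z
  proof -
    define a where "a = det2 z u2 / det2 u1 u2"
    define b where "b = det2 u1 z / det2 u1 u2"
    have z: "z = a *\<^sub>R u1 + b *\<^sub>R u2" unfolding a_def b_def by (rule det2_coordinates[OF basis])
    have "X z = a" "Y z = b" unfolding X_def Y_def by (subst z, use u v12 in \<open>simp add: det2_algebra\<close>)+
    with z show ?thesis by simp
  qed
  define P where "P = (\<lambda>z. (X z, Y z)) ` differences S"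
  have v3: "X z + Y z = 1 * det2 v3 z" for z
    by (subst (3) XY) (simp add: det2_algebra u)
  have v4: "X z + (det2 v4 u2 / det2 v4 u1) * Y z = (1 / det2 v4 u1) * det2 v4 z" for z
    by (subst (3) XY) (use u in \<open>simp add: det2_algebra field_simps\<close>)
  have X: "X z = (1 / det2 v1 u1) * det2 v1 z" and Y: "Y z = (1 / det2 v2 u2) * det2 v2 z" for z
    unfolding X_def Y_def by simp_all
  obtain F where F: "finite F" "differences (det2 v1 ` S) \<subseteq> Q.span F"
    using differences_in_finite_span supports_relatively_dense[OF sup(1)]
      supports_uniformly_locally_finite[OF sup(1)] by blast
  obtain M where M: "\<And>z. nrm z \<le> K \<Longrightarrow> \<bar>X z\<bar> \<le> M \<and> \<bar>Y z\<bar> \<le> M"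
  proof
    fix z assume z: "nrm z \<le> K"
    have "\<bar>det2 v1 z\<bar> \<le> K" "\<bar>det2 v2 z\<bar> \<le> K" using sup z unfolding supports_def by (meson order_trans)+
    then have "\<bar>X z\<bar> \<le> K / \<bar>det2 v1 u1\<bar>" "\<bar>Y z\<bar> \<le> K / \<bar>det2 v2 u2\<bar>"
      unfolding X_def Y_def abs_divide by (intro divide_right_mono; simp)+
    then show "\<bar>X z\<bar> \<le> max (K / \<bar>det2 v1 u1\<bar>) (K / \<bar>det2 v2 u2\<bar>) \<and>
        \<bar>Y z\<bar> \<le> max (K / \<bar>det2 v1 u1\<bar>) (K / \<bar>det2 v2 u2\<bar>)" by auto
  qed
  show ?thesis
  proof (rule algebraic_if_four_directions[where P = P and M = M and F = "(*) (1 / det2 v1 u1) ` F"])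
    fix a b
    obtain q where q: "q \<in> S" using dense by blast
    obtain p where p: "p \<in> S" "nrm (q + a *\<^sub>R u1 + b *\<^sub>R u2 - p) \<le> K" using dense by blast
    define z where "z = p - q"
    define e where "e = q + a *\<^sub>R u1 + b *\<^sub>R u2 - p"
    have "z = a *\<^sub>R u1 + b *\<^sub>R u2 - e" unfolding z_def e_def by simp
    then have "X z = a - X e" "Y z = b - Y e"
      unfolding X_def Y_def using u v12 by (simp_all add: det2_algebra diff_divide_distrib)
    then have "\<bar>X z - a\<bar> \<le> M" "\<bar>Y z - b\<bar> \<le> M" using M[of e] p(2) unfolding e_def by auto
    moreover have "(X z, Y z) \<in> P" unfolding P_def z_def differences_def using p q by blast
    ultimately show "\<exists>(x, y)\<in>P. \<bar>x - a\<bar> \<le> M \<and> \<bar>y - b\<bar> \<le> M" by blast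
  next
    show "has_asymptotic_slopes (fst ` P)"
      unfolding P_def image_image fst_conv X by (rule supports_has_asymptotic_slopes) (use sup v12 in auto)
    show "has_asymptotic_slopes (snd ` P)"
      unfolding P_def image_image snd_conv Y by (rule supports_has_asymptotic_slopes) (use sup v12 in auto)
    show "has_asymptotic_slopes ((\<lambda>(x, y). x + y) ` P)"
      unfolding P_def image_image prod.case v3 by (rule supports_has_asymptotic_slopes) (use sup in auto)
    show "has_asymptotic_slopes ((\<lambda>(x, y). x + det2 v4 u2 / det2 v4 u1 * y) ` P)"
      unfolding P_def image_image prod.case v4 by (rule supports_has_asymptotic_slopes) (use sup u in auto)
    show "fst ` P \<subseteq> Q.span ((*) (1 / det2 v1 u1) ` F)"
    proof -
      have "X z \<in> Q.span ((*) (1 / det2 v1 u1) ` F)" if "z \<in> differences S" for z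
      proof -
        have "det2 v1 z \<in> differences (det2 v1 ` S)"
          using that unfolding differences_def by (fastforce simp: det2_algebra)
        then show ?thesis unfolding X using F(2) by (intro Q_span_scale_image) blast
      qed
      then show ?thesis unfolding P_def by auto
    qed
  qed (use F in simp)
qed

text \<open>A suitable basis gives three directions the slopes 0, 1 and infinity, and
  \<open>algebraic_ratio\<close> handles all others; with fewer directions the basis alone settles
  the matter.\<close>

lemma algebraic_slopes:
  "\<exists>e1 e2. coordinate_system e1 e2 \<and> (\<forall>I. I edge_of unit_ball nrm \<longrightarrow> algebraic_slope (slope e1 e2 I))"
proof -
  have edge: "\<exists>v p q. supports (det2 v) \<and> p \<in> I \<and> q \<in> I \<and> p \<noteq> q \<and> (\<forall>x\<in>I. det2 v x = 1)"
    if I: "I edge_of unit_ball nrm" for I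
  proof -
    obtain v p q where v: "\<And>x. \<bar>det2 v x\<bar> \<le> nrm x" "\<And>x. x \<in> I \<Longrightarrow> det2 v x = 1"
      and pq: "p \<in> I" "q \<in> I" "p \<noteq> q" "I \<subseteq> unit_ball nrm"
      using edge_functional[OF polygon I] by metis
    have "nrm p \<le> 1" "nrm q \<le> 1" using pq unfolding unit_ball_def by auto
    then have "\<exists>\<theta> \<epsilon>. \<epsilon> > 0 \<and> nrm \<theta> = 1 \<and> (\<forall>x. nrm (x - \<theta>) \<le> \<epsilon> \<longrightarrow> nrm x = det2 v x)"
      by (rule norm_eq_det2_near_midpoint[OF v(1) v(2)[OF pq(1)] v(2)[OF pq(2)] pq(3)])
    then have "supports (det2 v)" unfolding supports_def using v(1) linear_det2 by blast
    then show ?thesis using v pq by blast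
  qed
  have reduce: ?thesis if "det2 e1 e2 \<noteq> 0"
    and alg: "\<And>v. supports (det2 v) \<Longrightarrow> det2 v e2 = 0 \<or> algebraic (- det2 v e1 / det2 v e2)" for e1 e2
  proof (intro exI conjI allI impI)
    show cs: "coordinate_system e1 e2" using that coordinate_system_iff_det2 by blast
    fix I assume "I edge_of unit_ball nrm"
    from edge[OF this] obtain v p q where v: "supports (det2 v)" "p \<in> I" "q \<in> I" "p \<noteq> q"
      "\<And>x. x \<in> I \<Longrightarrow> det2 v x = 1" by blast
    have "slope e1 e2 I = (if det2 v e2 = 0 then \<infinity> else ereal (- det2 v e1 / det2 v e2))"
      by (rule slope_edge[OF cs v(2-5)])
    then show "algebraic_slope (slope e1 e2 I)"
      unfolding algebraic_slope_def using alg[OF v(1)] by auto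
  qed
  show ?thesis
  proof (cases "\<exists>v1 v2. supports (det2 v1) \<and> supports (det2 v2) \<and> det2 v1 v2 \<noteq> 0")
    case False
    show ?thesis
    proof (cases "\<exists>v. supports (det2 v)")
      case True
      then obtain v where v: "supports (det2 v)" by blast
      have "v \<noteq> 0"
      proof
        assume "v = 0"
        then show False using v unfolding supports_def
          by (metis det2_algebra(9) diff_self less_imp_le nrm_0 zero_neq_one)
      qed
      then have "\<exists>w. det2 w v \<noteq> 0"
        by (intro exI[of _ "vector [v $ 2, - v $ 1]"]) (auto simp: det2_def vec_eq_iff forall_2 sum_squares_eq_zero_iff)
      then obtain w where "det2 w v \<noteq> 0" by blast
      \<comment> \<open>All supporting functionals are proportional, so with \<open>v\<close> as
        second basis vector every slope is infinite.\<close>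
      then show ?thesis using False v by (intro reduce[of w v]) blast+
    next
      case False
      have "det2 (vector [1, 0]) (vector [0, 1]) \<noteq> 0" by (simp add: det2_def)
      then show ?thesis using False by (intro reduce) blast+
    qed
  next
    case True
    then obtain v1 v2 where v12: "supports (det2 v1)" "supports (det2 v2)" "det2 v1 v2 \<noteq> 0" by blast
    then have v21: "det2 v2 v1 \<noteq> 0" using det2_swap[of v1 v2] by simp
    show ?thesis
    proof (cases "\<exists>v3. supports (det2 v3) \<and> det2 v3 v1 \<noteq> 0 \<and> det2 v3 v2 \<noteq> 0")
      case False
      show ?thesis
      \<comment> \<open>The two directions become the axes, leaving only the slopes 0 and
        infinity.\<close>
      proof (rule reduce[of v2 v1])
        show "det2 v v1 = 0 \<or> algebraic (- det2 v v2 / det2 v v1)" if "supports (det2 v)" for v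
          using False that by auto
      qed fact
    next
      case True
      then obtain v3 where v3: "supports (det2 v3)" "det2 v3 v1 \<noteq> 0" "det2 v3 v2 \<noteq> 0" by blast
      define u1 where "u1 = (1 / det2 v3 v2) *\<^sub>R v2"
      define u2 where "u2 = (1 / det2 v3 v1) *\<^sub>R v1"
      have u: "det2 v2 u1 = 0" "det2 v1 u2 = 0" "det2 v3 u1 = 1" "det2 v3 u2 = 1"
        "det2 v1 u1 \<noteq> 0" "det2 v2 u2 \<noteq> 0" "det2 u1 u2 \<noteq> 0"
        unfolding u1_def u2_def using v12 v21 v3 by (simp_all add: det2_algebra)
      show ?thesis
      \<comment> \<open>The sign turns the slope of \<open>v\<close> into
        \<open>det2 v u2 / det2 v u1\<close>.\<close>
      proof (rule reduce[of u2 "(- 1) *\<^sub>R u1"])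
        show "det2 u2 ((- 1) *\<^sub>R u1) \<noteq> 0" using u(7) det2_swap[of u1 u2] by (simp only: det2_algebra)
        show "det2 v ((- 1) *\<^sub>R u1) = 0 \<or> algebraic (- det2 v u2 / det2 v ((- 1) *\<^sub>R u1))"
          if "supports (det2 v)" for v
        proof -
          have "det2 v ((- 1) *\<^sub>R u1) = - det2 v u1" unfolding det2_algebra by simp
          then show ?thesis using algebraic_ratio[OF v12(1,2) v3(1) that u(1-4) _ u(5-7)] by auto
        qed
      qed
    qed
  qed
qed

end

section \<open>Relatively dense sets adapted to algebraic numbers\<close>

text \<open>\<open>M\<close> is the companion matrix of an integer polynomial p of least degree with
  root s, cleared of denominators. The powers of s form its left eigenvector, the coefficients of
  p(X)/(X - s) its right one; they pair to p'(s), which is non-zero.\<close>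

lemma algebraic_companion:
  fixes s :: real
  assumes "algebraic s"
  obtains e :: nat and c :: int and M :: "nat \<Rightarrow> nat \<Rightarrow> int" and w :: "nat \<Rightarrow> real"
  where "c \<noteq> 0"
    "\<And>l. l < e \<Longrightarrow> (\<Sum>k<e. s ^ k * of_int (M k l)) = of_int c * s * s ^ l"
    "\<And>k. k < e \<Longrightarrow> (\<Sum>l<e. of_int (M k l) * w l) = of_int c * s * w k"
    "(\<Sum>k<e. s ^ k * w k) \<noteq> 0"
proof -
  define R where "R p \<longleftrightarrow> (\<forall>i. coeff p i \<in> \<int>) \<and> p \<noteq> 0 \<and> poly p s = 0" for p :: "real poly"
  have "\<exists>p. R p" using assms unfolding R_def algebraic_def by blast
  then obtain p where p: "R p" and min: "\<And>q. R q \<Longrightarrow> degree p \<le> degree q"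
    using ex_has_least_nat[of R _ degree] by blast
  have deg: "degree p > 0"
  proof (rule ccontr)
    assume "\<not> degree p > 0"
    then obtain a where "p = [:a:]" by (metis degree_eq_zeroE gr0I)
    then show False using p unfolding R_def by auto
  qed
  have simple: "poly (pderiv p) s \<noteq> 0"
  proof
    assume "poly (pderiv p) s = 0"
    moreover have "coeff (pderiv p) i \<in> \<int>" for i
      unfolding coeff_pderiv using p unfolding R_def by (intro Ints_mult) auto
    moreover have "pderiv p \<noteq> 0" using deg by (simp add: pderiv_eq_0_iff)
    ultimately have "R (pderiv p)" unfolding R_def by blast
    then show False using min[of "pderiv p"] deg by (simp add: degree_pderiv)
  qed
  have "\<forall>i. \<exists>z. coeff p i = of_int z" using p unfolding R_def by (metis Ints_cases)
  then obtain a where a: "\<And>i. coeff p i = of_int (a i)" by metis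
  define e where "e = degree p"
  have e: "e > 0" "a e \<noteq> 0" using deg a[of e] unfolding e_def by auto
  have root: "(\<Sum>i\<le>e. of_int (a i) * s ^ i) = 0"
    using p unfolding R_def poly_altdef e_def a by simp
  \<comment> \<open>Horner's scheme: \<open>W (Suc k)\<close> is the coefficient of X^k in p(X)/(X -
    s), and \<open>W 0\<close> is p(s).\<close>
  define W where "W k = (\<Sum>i\<in>{k..e}. of_int (a i) * s ^ (i - k))" for k
  have W_rec: "W k = of_int (a k) + s * W (Suc k)" if "k \<le> e" for k
  proof -
    have "W k = of_int (a k) + (\<Sum>i\<in>{Suc k..e}. of_int (a i) * s ^ (i - k))"
      unfolding W_def using that by (simp add: sum.atLeast_Suc_atMost)
    also have "(\<Sum>i\<in>{Suc k..e}. of_int (a i) * s ^ (i - k)) = s * W (Suc k)"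
      unfolding W_def sum_distrib_left
    proof (rule sum.cong)
      fix i assume "i \<in> {Suc k..e}"
      then have "i - k = Suc (i - Suc k)" by auto
      then show "of_int (a i) * s ^ (i - k) = s * (of_int (a i) * s ^ (i - Suc k))" by simp
    qed simp
    finally show ?thesis .
  qed
  have W0: "W 0 = 0" using root unfolding W_def by (simp add: atLeast0AtMost)
  have We: "W e = of_int (a e)" unfolding W_def by simp
  \<comment> \<open>Column \<open>l\<close> expresses \<open>a e * s ^ Suc l\<close> by powers below
    \<open>e\<close>. Only the last column needs p(s) = 0; there \<open>k = Suc l\<close> is out of
    range.\<close>
  define M where "M k l = (if k = Suc l then a e else 0) - (if Suc l = e then a k else 0)" for k l
  show ?thesis
  proof (rule that[of "a e" e M "\<lambda>k. W (Suc k)"])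
    show "a e \<noteq> 0" by (rule e)
    fix l assume l: "l < e"
    have "(\<Sum>k<e. s ^ k * of_int (M k l)) =
        (\<Sum>k<e. if k = Suc l then s ^ k * of_int (a e) else 0) - (\<Sum>k<e. if Suc l = e then s ^ k * of_int (a k) else 0)"
      unfolding M_def sum_subtractf[symmetric] by (intro sum.cong) (auto simp: algebra_simps)
    also have "\<dots> = of_int (a e) * s * s ^ l"
    proof (cases "Suc l = e")
      case True
      have "(\<Sum>i\<le>e. of_int (a i) * s ^ i) = (\<Sum>i<e. of_int (a i) * s ^ i) + of_int (a e) * s ^ e"
        by (simp add: lessThan_Suc_atMost[symmetric])
      then have "(\<Sum>k<e. s ^ k * of_int (a k)) = - (of_int (a e) * s ^ e)"
        using root by (simp add: mult.commute)
      then show ?thesis using True by auto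
    qed (use l in \<open>auto simp: sum.delta\<close>)
    finally show "(\<Sum>k<e. s ^ k * of_int (M k l)) = of_int (a e) * s * s ^ l" .
  next
    fix k assume k: "k < e"
    have "(\<Sum>l<e. of_int (M k l) * W (Suc l)) =
        (\<Sum>l<e. if k = Suc l then of_int (a e) * W (Suc l) else 0) -
        (\<Sum>l<e. if l = e - 1 then of_int (a k) * W (Suc l) else 0)"
      unfolding M_def sum_subtractf[symmetric] using e by (intro sum.cong) (auto simp: algebra_simps)
    also have "(\<Sum>l<e. if l = e - 1 then of_int (a k) * W (Suc l) else 0) = of_int (a k) * of_int (a e)"
      using e We by (simp add: sum.delta)
    also have "(\<Sum>l<e. if k = Suc l then of_int (a e) * W (Suc l) else 0) = of_int (a e) * W k"
    proof (cases k)
      case 0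
      then show ?thesis using W0 by simp
    next
      case (Suc k')
      then have "(\<Sum>l<e. if k = Suc l then of_int (a e) * W (Suc l) else 0) =
          (\<Sum>l<e. if l = k' then of_int (a e) * W (Suc l) else 0)" by (intro sum.cong) auto
      then show ?thesis using Suc k by (simp add: sum.delta)
    qed
    also have "of_int (a e) * W k - of_int (a k) * of_int (a e) = of_int (a e) * s * W (Suc k)"
      using W_rec[of k] k by (simp add: algebra_simps)
    finally show "(\<Sum>l<e. of_int (M k l) * W (Suc l)) = of_int (a e) * s * W (Suc k)" .
  next
    \<comment> \<open>After exchanging the sums, index \<open>i\<close> occurs once for each
      \<open>k < i\<close>, which gives the factor of the derivative; at \<open>i = 0\<close> this
      factor vanishes, so the truncated exponent is harmless.\<close>
    have "(\<Sum>k<e. s ^ k * W (Suc k)) = (\<Sum>k<e. \<Sum>i\<le>e. if k < i then of_int (a i) * s ^ (i - 1) else 0)"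
    proof (rule sum.cong)
      fix k assume "k \<in> {..<e}"
      have "s ^ k * W (Suc k) = (\<Sum>i\<in>{Suc k..e}. of_int (a i) * s ^ (i - 1))"
        unfolding W_def sum_distrib_left
      proof (rule sum.cong)
        fix i assume "i \<in> {Suc k..e}"
        then have "s ^ (i - 1) = s ^ k * s ^ (i - Suc k)" by (simp add: power_add[symmetric])
        then show "s ^ k * (of_int (a i) * s ^ (i - Suc k)) = of_int (a i) * s ^ (i - 1)" by simp
      qed simp
      also have "\<dots> = (\<Sum>i\<le>e. if k < i then of_int (a i) * s ^ (i - 1) else 0)"
        by (intro sum.mono_neutral_cong_left) auto
      finally show "s ^ k * W (Suc k) = (\<Sum>i\<le>e. if k < i then of_int (a i) * s ^ (i - 1) else 0)" .
    qed simp
    also have "\<dots> = (\<Sum>i\<le>e. \<Sum>k<e. if k < i then of_int (a i) * s ^ (i - 1) else 0)" by (rule sum.swap)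
    also have "\<dots> = (\<Sum>i\<le>e. of_nat i * (of_int (a i) * s ^ (i - 1)))"
    proof (rule sum.cong)
      fix i assume "i \<in> {..e}"
      then have "(\<Sum>k<e. if k < i then of_int (a i) * s ^ (i - 1) else 0) = (\<Sum>k<i. of_int (a i) * s ^ (i - 1))"
        by (intro sum.mono_neutral_cong_right) auto
      then show "(\<Sum>k<e. if k < i then of_int (a i) * s ^ (i - 1) else 0) = of_nat i * (of_int (a i) * s ^ (i - 1))"
        by simp
    qed simp
    also have "\<dots> = poly (pderiv p) s"
    proof -
      obtain e' where e': "e = Suc e'" using e by (cases e) auto
      have "poly (pderiv p) s = (\<Sum>i\<le>e'. of_nat (Suc i) * (of_int (a (Suc i)) * s ^ i))"
        using e' unfolding poly_altdef degree_pderiv coeff_pderiv a e_def by (simp add: mult.assoc)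
      then show ?thesis unfolding e' sum.atMost_Suc_shift by simp
    qed
    finally show "(\<Sum>k<e. s ^ k * W (Suc k)) \<noteq> 0" using simple by simp
  qed
qed

text \<open>Near the line a value is, up to a bounded error, \<rho> times the non-zero pairing.
  Values up to \<open>N\<close> thus force \<rho> into an interval of length O(N), and boundedly
  many integer vectors are close to each unit piece.\<close>

lemma lattice_points_near_line:
  fixes \<phi> u :: "'i \<Rightarrow> real" and B :: real
  assumes I: "finite I" and \<sigma>: "(\<Sum>i\<in>I. \<phi> i * u i) \<noteq> 0" and B: "B \<ge> 0"
  defines "Z \<equiv> {\<Sum>i\<in>I. \<phi> i * of_int (k i) | k :: 'i \<Rightarrow> int. \<exists>\<rho>. \<forall>i\<in>I. \<bar>of_int (k i) - \<rho> * u i\<bar> \<le> B}"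
  shows "\<exists>C\<ge>0. \<forall>N\<ge>1. finite (Z \<inter> {-N..N}) \<and> real (card (Z \<inter> {-N..N})) \<le> C * N"
proof -
  define \<sigma>' where "\<sigma>' = (\<Sum>i\<in>I. \<phi> i * u i)"
  define E where "E = B * (\<Sum>i\<in>I. \<bar>\<phi> i\<bar>)"
  define D where "D = (1 + E) / \<bar>\<sigma>'\<bar>"
  \<comment> \<open>Rounding \<rho> to an integer moves coordinate \<open>i\<close> by at most
    \<open>\<bar>u i\<bar>\<close>; \<open>B'\<close> allows for this in all coordinates.\<close>
  define B' where "B' = B + (\<Sum>i\<in>I. \<bar>u i\<bar>)"
  have E: "E \<ge> 0" unfolding E_def using B by (simp add: sum_nonneg)
  have D: "D \<ge> 0" unfolding D_def using E by simp
  have \<sigma>'0: "\<sigma>' \<noteq> 0" using \<sigma> unfolding \<sigma>'_def .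
  define m where "m = nat \<lfloor>2 * B' + 1\<rfloor>"
  define V where "V j = PiE I (\<lambda>i. {\<lceil>real_of_int j * u i - B'\<rceil>..\<lfloor>real_of_int j * u i + B'\<rfloor>})" for j :: int
  have finV: "finite (V j)" for j unfolding V_def using I by (intro finite_PiE) auto
  have cardV: "card (V j) \<le> m ^ card I" for j
  proof -
    have "card (V j) \<le> (\<Prod>i\<in>I. m)"
      unfolding V_def card_PiE[OF I]
    proof (rule prod_mono, intro conjI)
      fix i assume "i \<in> I"
      have "\<lfloor>real_of_int j * u i + B'\<rfloor> - \<lceil>real_of_int j * u i - B'\<rceil> + 1 \<le> \<lfloor>2 * B' + 1\<rfloor>" by linarith
      then show "card {\<lceil>real_of_int j * u i - B'\<rceil>..\<lfloor>real_of_int j * u i + B'\<rfloor>} \<le> m"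
        unfolding m_def by simp
    qed simp
    then show ?thesis by simp
  qed
  define val where "val k = (\<Sum>i\<in>I. \<phi> i * of_int (k i))" for k :: "'i \<Rightarrow> int"
  define C where "C = (2 * D + 5) * real (m ^ card I)"
  have "finite (Z \<inter> {-N..N}) \<and> real (card (Z \<inter> {-N..N})) \<le> C * N" if N: "N \<ge> 1" for N
  proof -
    define J where "J = nat \<lceil>D * N\<rceil> + 1"
    let ?U = "\<Union>j\<in>{- int J..int J}. val ` V j"
    have sub: "Z \<inter> {-N..N} \<subseteq> ?U"
    proof
      fix z assume z: "z \<in> Z \<inter> {-N..N}"
      then obtain k :: "'i \<Rightarrow> int" and \<rho> where k: "z = (\<Sum>i\<in>I. \<phi> i * of_int (k i))"
        "\<And>i. i \<in> I \<Longrightarrow> \<bar>of_int (k i) - \<rho> * u i\<bar> \<le> B" unfolding Z_def by blast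
      have "z - \<rho> * \<sigma>' = (\<Sum>i\<in>I. \<phi> i * (of_int (k i) - \<rho> * u i))"
        unfolding k \<sigma>'_def by (simp add: sum_distrib_left sum_subtractf algebra_simps)
      also have "\<bar>\<dots>\<bar> \<le> (\<Sum>i\<in>I. \<bar>\<phi> i\<bar> * B)"
        by (rule order_trans[OF sum_abs]) (auto simp: abs_mult intro!: sum_mono mult_left_mono k)
      also have "\<dots> = E" unfolding E_def by (simp add: sum_distrib_left mult.commute)
      finally have "\<bar>\<rho> * \<sigma>'\<bar> \<le> N + E" using z by (auto simp: abs_le_iff)
      also have "\<dots> \<le> (1 + E) * N" using mult_left_mono[OF N E] by (simp add: algebra_simps)
      finally have "\<bar>\<rho>\<bar> \<le> D * N"
        unfolding D_def using \<sigma>'0 by (simp add: abs_mult field_simps)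
      then have J: "\<lfloor>\<rho>\<rfloor> \<in> {- int J..int J}" unfolding J_def by (auto; linarith)
      have "restrict k I \<in> V \<lfloor>\<rho>\<rfloor>"
        unfolding V_def
      proof (intro restrict_PiE_iff[THEN iffD2] ballI)
        fix i assume i: "i \<in> I"
        have "\<bar>\<rho> * u i - of_int \<lfloor>\<rho>\<rfloor> * u i\<bar> = \<bar>\<rho> - of_int \<lfloor>\<rho>\<rfloor>\<bar> * \<bar>u i\<bar>"
          unfolding left_diff_distrib[symmetric] abs_mult ..
        also have "\<dots> \<le> 1 * \<bar>u i\<bar>" by (intro mult_right_mono) linarith+
        also have "1 * \<bar>u i\<bar> \<le> (\<Sum>i\<in>I. \<bar>u i\<bar>)" using member_le_sum[of i I "\<lambda>i. \<bar>u i\<bar>"] i I by simp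
        finally have "\<bar>of_int (k i) - of_int \<lfloor>\<rho>\<rfloor> * u i\<bar> \<le> B'" using k(2)[OF i] unfolding B'_def by linarith
        then show "k i \<in> {\<lceil>of_int \<lfloor>\<rho>\<rfloor> * u i - B'\<rceil>..\<lfloor>of_int \<lfloor>\<rho>\<rfloor> * u i + B'\<rfloor>}"
          by (simp add: abs_le_iff ceiling_le_iff le_floor_iff)
      qed
      moreover have "val (restrict k I) = z" unfolding val_def k by (intro sum.cong) auto
      ultimately show "z \<in> ?U" using J by blast
    qed
    have "finite ?U" using finV by blast
    then have fin: "finite (Z \<inter> {-N..N})" using sub finite_subset by blast
    have "card (Z \<inter> {-N..N}) \<le> card ?U" using \<open>finite ?U\<close> sub by (rule card_mono)
    also have "\<dots> \<le> (\<Sum>j\<in>{- int J..int J}. card (val ` V j))" by (rule card_UN_le) simp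
    also have "\<dots> \<le> (\<Sum>j\<in>{- int J..int J}. m ^ card I)"
      by (intro sum_mono order_trans[OF card_image_le[OF finV] cardV])
    also have "\<dots> = (2 * J + 1) * m ^ card I"
    proof -
      have "card {- int J..int J} = 2 * J + 1" by (simp add: nat_add_distrib nat_mult_distrib)
      then show ?thesis by (simp only: sum_constant of_nat_id)
    qed
    finally have "real (card (Z \<inter> {-N..N})) \<le> real ((2 * J + 1) * m ^ card I)" by (rule of_nat_mono)
    also have "\<dots> = (2 * real J + 1) * real (m ^ card I)" by (simp add: algebra_simps)
    also have "\<dots> \<le> ((2 * D + 5) * N) * real (m ^ card I)"
    proof (rule mult_right_mono)
      have "D * N \<ge> 0" using D N by simp
      then have "real J \<le> D * N + 2" unfolding J_def by linarith
      then show "2 * real J + 1 \<le> (2 * D + 5) * N" using N by (simp add: algebra_simps)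
    qed simp
    finally show ?thesis using fin unfolding C_def by (simp add: mult_ac)
  qed
  moreover have "C \<ge> 0" unfolding C_def using D by simp
  ultimately show ?thesis by blast
qed

text \<open>The numbers \<open>\<Sum>i. \<phi> i * n i\<close>, where \<open>\<phi>\<close> lists the monomials in the elements of \<open>T\<close> and the
  integer vector \<open>n\<close> stays close to a line \<open>\<real> u\<close>. Multiplication by \<open>s \<in> T\<close> lifts to a
  rational matrix (a companion matrix in one tensor factor) with \<open>\<phi>\<close> as left and \<open>u\<close> as right
  eigenvector, so that it keeps integer vectors near the line.\<close>

lemma algebraic_numbers_lattice:
  assumes T: "finite T" and alg: "\<And>s. s \<in> T \<Longrightarrow> algebraic s"
  obtains A :: "real set" and M :: real
  where "\<And>x. \<exists>a\<in>A. \<bar>x - a\<bar> \<le> M"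
    "\<And>s. s \<in> T \<Longrightarrow> \<exists>C\<ge>0. \<forall>N\<ge>1.
       finite ({(y - y') - s * (x - x') | x x' y y'. {x, x', y, y'} \<subseteq> A} \<inter> {-N..N}) \<and>
       real (card ({(y - y') - s * (x - x') | x x' y y'. {x, x', y, y'} \<subseteq> A} \<inter> {-N..N})) \<le> C * N"
proof -
  define R where "R s x \<longleftrightarrow> (case x of (e, c, M, w) \<Rightarrow> c \<noteq> (0::int) \<and>
    (\<forall>l<e. (\<Sum>k<e. s ^ k * of_int (M k l :: int)) = of_int c * s * s ^ l) \<and>
    (\<forall>k<e. (\<Sum>l<e. of_int (M k l) * w l) = of_int c * s * w k) \<and>
    (\<Sum>k<e::nat. s ^ k * w k) \<noteq> (0::real))" for s x
  have "\<exists>x. R s x" if "s \<in> T" for s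
  proof -
    have "algebraic s" using alg that by blast
    then obtain e c M w where x: "c \<noteq> 0"
      "\<And>l. l < e \<Longrightarrow> (\<Sum>k<e. s ^ k * of_int (M k l :: int)) = of_int c * s * s ^ l"
      "\<And>k. k < e \<Longrightarrow> (\<Sum>l<e. of_int (M k l) * w l) = of_int c * s * w k"
      "(\<Sum>k<e. s ^ k * w k) \<noteq> 0"
      by (rule algebraic_companion) blast
    then have "R s (e, c, M, w)" unfolding R_def by simp
    then show ?thesis by blast
  qed
  then obtain g where g: "\<And>s. s \<in> T \<Longrightarrow> R s (g s)" by metis
  define e where "e s = fst (g s)" for s
  define c where "c s = fst (snd (g s))" for s
  define M where "M s = fst (snd (snd (g s)))" for s
  define w where "w s = snd (snd (snd (g s)))" for s
  have c0: "c s \<noteq> 0"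
    and left: "\<And>l. l < e s \<Longrightarrow> (\<Sum>k<e s. s ^ k * of_int (M s k l)) = of_int (c s) * s * s ^ l"
    and right: "\<And>k. k < e s \<Longrightarrow> (\<Sum>l<e s. of_int (M s k l) * w s l) = of_int (c s) * s * w s k"
    and nz: "(\<Sum>k<e s. s ^ k * w s k) \<noteq> 0" if "s \<in> T" for s
    using g[OF that] unfolding R_def e_def c_def M_def w_def by (auto split: prod.splits)
  \<comment> \<open>Multi-indices of the tensor product: \<open>i s\<close> is the exponent of
    \<open>s\<close>, and \<phi> and \<open>u\<close> are tensor products of the left and right
    eigenvectors.\<close>
  define I where "I = PiE T (\<lambda>s. {..<e s})"
  define \<phi> where "\<phi> i = (\<Prod>s\<in>T. s ^ i s)" for i :: "real \<Rightarrow> nat"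
  define u where "u i = (\<Prod>s\<in>T. w s (i s))" for i :: "real \<Rightarrow> nat"
  have finI: "finite I" unfolding I_def using T by (intro finite_PiE) auto
  have I_less: "i s < e s" if "i \<in> I" "s \<in> T" for i s using that unfolding I_def by auto
  have I_upd: "i(s := k) \<in> I" if "i \<in> I" "s \<in> T" "k < e s" for i s k
    using that unfolding I_def by (auto simp: PiE_iff extensional_def)
  have \<phi>_upd: "\<phi> (i(s := k)) = s ^ k * (\<Prod>r\<in>T - {s}. r ^ i r)" if "s \<in> T" for i s k
    unfolding \<phi>_def prod.remove[OF T that] by (auto intro: prod.cong)
  have u_upd: "u (i(s := k)) = w s k * (\<Prod>r\<in>T - {s}. w r (i r))" if "s \<in> T" for i s k
    unfolding u_def prod.remove[OF T that] by (auto intro: prod.cong)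
  have \<sigma>: "(\<Sum>i\<in>I. \<phi> i * u i) \<noteq> 0"
  proof -
    have "(\<Prod>s\<in>T. \<Sum>k<e s. s ^ k * w s k) = (\<Sum>i\<in>I. \<Prod>s\<in>T. s ^ i s * w s (i s))"
      unfolding I_def by (rule prod_sum_PiE) (use T in auto)
    also have "\<dots> = (\<Sum>i\<in>I. \<phi> i * u i)" unfolding \<phi>_def u_def by (simp add: prod.distrib)
    finally have "(\<Sum>i\<in>I. \<phi> i * u i) = (\<Prod>s\<in>T. \<Sum>k<e s. s ^ k * w s k)" ..
    moreover have "(\<Prod>s\<in>T. \<Sum>k<e s. s ^ k * w s k) \<noteq> 0" using nz T by simp
    ultimately show ?thesis by simp
  qed
  \<comment> \<open>The integer matrix of \<open>s\<close> acts on its own tensor factor and leaves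
    the others alone.\<close>
  define op where "op s n i = (\<Sum>k<e s. M s (i s) k * n (i(s := k)))" for s i and n :: "(real \<Rightarrow> nat) \<Rightarrow> int"
  have op_left: "(\<Sum>i\<in>I. \<phi> i * of_int (op s n i)) = of_int (c s) * s * (\<Sum>i\<in>I. \<phi> i * of_int (n i))"
    if s: "s \<in> T" for s n
  proof -
    have "(\<Sum>i\<in>I. \<phi> i * of_int (op s n i)) =
        (\<Sum>i\<in>I. \<Sum>k<e s. \<phi> i * of_int (M s (i s) k) * of_int (n (i(s := k))))"
      unfolding op_def by (simp add: sum_distrib_left mult.assoc)
    also have "\<dots> = (\<Sum>(i, k)\<in>I \<times> {..<e s}. \<phi> i * of_int (M s (i s) k) * of_int (n (i(s := k))))"
      by (simp add: sum.cartesian_product)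
    \<comment> \<open>Exchanging \<open>i s\<close> with the summation index is an involution; it
      moves the matrix over to \<phi>, where the left eigenvector equation applies.\<close>
    also have "\<dots> = (\<Sum>(i, l)\<in>I \<times> {..<e s}. \<phi> (i(s := l)) * of_int (M s l (i s)) * of_int (n i))"
      by (rule sum.reindex_bij_witness[of _ "\<lambda>(i, k). (i(s := k), i s)" "\<lambda>(i, k). (i(s := k), i s)"])
        (use s I_less I_upd in auto)
    also have "\<dots> = (\<Sum>i\<in>I. \<Sum>l<e s. \<phi> (i(s := l)) * of_int (M s l (i s)) * of_int (n i))"
      by (simp add: sum.cartesian_product)
    also have "\<dots> = (\<Sum>i\<in>I. of_int (c s) * s * (\<phi> i * of_int (n i)))"
    proof (rule sum.cong)
      fix i assume i: "i \<in> I"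
      define q where "q = (\<Prod>r\<in>T - {s}. r ^ i r)"
      have "(\<Sum>l<e s. \<phi> (i(s := l)) * of_int (M s l (i s)) * of_int (n i)) =
          (\<Sum>l<e s. s ^ l * of_int (M s l (i s))) * (q * of_int (n i))"
        unfolding \<phi>_upd[OF s] q_def[symmetric] sum_distrib_right by (intro sum.cong) auto
      also have "\<dots> = of_int (c s) * s * s ^ i s * (q * of_int (n i))"
        unfolding left[OF s I_less[OF i s]] ..
      also have "\<dots> = of_int (c s) * s * (\<phi> i * of_int (n i))"
        using \<phi>_upd[OF s, of i "i s"] unfolding q_def by simp
      finally show "(\<Sum>l<e s. \<phi> (i(s := l)) * of_int (M s l (i s)) * of_int (n i)) =
        of_int (c s) * s * (\<phi> i * of_int (n i))" .
    qed simp
    finally show ?thesis by (simp add: sum_distrib_left)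
  qed
  have op_right: "(\<Sum>k<e s. of_int (M s (i s) k) * u (i(s := k))) = of_int (c s) * s * u i"
    if s: "s \<in> T" and i: "i \<in> I" for s i
  proof -
    define q where "q = (\<Prod>r\<in>T - {s}. w r (i r))"
    have "(\<Sum>k<e s. of_int (M s (i s) k) * u (i(s := k))) = (\<Sum>k<e s. of_int (M s (i s) k) * w s k) * q"
      unfolding u_upd[OF s] q_def[symmetric] sum_distrib_right by (intro sum.cong) auto
    also have "\<dots> = of_int (c s) * s * w s (i s) * q" unfolding right[OF s I_less[OF i s]] ..
    also have "\<dots> = of_int (c s) * s * u i" using u_upd[OF s, of i "i s"] unfolding q_def by simp
    finally show ?thesis .
  qed
  define val where "val n = (\<Sum>i\<in>I. \<phi> i * of_int (n i))" for n :: "(real \<Rightarrow> nat) \<Rightarrow> int"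
  define A where "A = {val n | n. \<exists>r. \<forall>i\<in>I. \<bar>of_int (n i) - r * u i\<bar> \<le> 1}"
  show ?thesis
  proof (rule that[of A "\<Sum>i\<in>I. \<bar>\<phi> i\<bar>"])
    fix x :: real
    \<comment> \<open>\<open>r\<close> marks the point of the line with value \<open>x\<close>;
      rounding down its coordinates produces the error \<open>M\<close>.\<close>
    define r where "r = x / (\<Sum>i\<in>I. \<phi> i * u i)"
    define n where "n i = \<lfloor>r * u i\<rfloor>" for i
    have n: "\<bar>of_int (n i) - r * u i\<bar> \<le> 1" for i unfolding n_def by linarith
    have "x - val n = (\<Sum>i\<in>I. \<phi> i * (r * u i - of_int (n i)))"
    proof -
      have "x = r * (\<Sum>i\<in>I. \<phi> i * u i)" unfolding r_def using \<sigma> by simp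
      then show ?thesis unfolding val_def by (simp add: sum_distrib_left sum_subtractf algebra_simps)
    qed
    also have "\<bar>\<dots>\<bar> \<le> (\<Sum>i\<in>I. \<bar>\<phi> i\<bar> * 1)"
    proof (rule order_trans[OF sum_abs sum_mono])
      fix i
      show "\<bar>\<phi> i * (r * u i - of_int (n i))\<bar> \<le> \<bar>\<phi> i\<bar> * 1"
        unfolding abs_mult using n[of i] by (intro mult_left_mono) (auto simp: abs_minus_commute)
    qed
    finally have "\<bar>x - val n\<bar> \<le> (\<Sum>i\<in>I. \<bar>\<phi> i\<bar>)" by simp
    moreover have "val n \<in> A" unfolding A_def using n by blast
    ultimately show "\<exists>a\<in>A. \<bar>x - a\<bar> \<le> (\<Sum>i\<in>I. \<bar>\<phi> i\<bar>)" by blast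
  next
    fix s assume s: "s \<in> T"
    \<comment> \<open>Differences of two admissible vectors are within 2 of the line; the summands
      of \<open>B\<close> are this error after scaling by \<open>c s\<close> and after applying
      \<open>op s\<close>.\<close>
    define B where "B = 2 * \<bar>real_of_int (c s)\<bar> + 2 * (\<Sum>k<e s. \<Sum>l<e s. \<bar>real_of_int (M s k l)\<bar>)"
    define Z where "Z = {\<Sum>i\<in>I. \<phi> i * of_int (k i) | k. \<exists>\<rho>. \<forall>i\<in>I. \<bar>of_int (k i) - \<rho> * u i\<bar> \<le> B}"
    have "B \<ge> 0" unfolding B_def by (simp add: sum_nonneg)
    from lattice_points_near_line[OF finI \<sigma> this] obtain C where C: "C \<ge> 0"
      "\<And>N. N \<ge> 1 \<Longrightarrow> finite (Z \<inter> {-N..N}) \<and> real (card (Z \<inter> {-N..N})) \<le> C * N"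
      unfolding Z_def by blast
    let ?G = "{(y - y') - s * (x - x') | x x' y y'. {x, x', y, y'} \<subseteq> A}"
    let ?c = "real_of_int (c s)"
    have c1: "\<bar>?c\<bar> \<ge> 1" using c0[OF s] by linarith
    \<comment> \<open>The factor \<open>c s\<close> clears the denominator in multiplication by
      \<open>s\<close>, so the result is again the value of an integer vector near the line.\<close>
    have cG: "?c * z \<in> Z" if z: "z \<in> ?G" for z
    proof -
      have "\<exists>n r. a = val n \<and> (\<forall>i\<in>I. \<bar>of_int (n i) - r * u i\<bar> \<le> 1)" if "a \<in> A" for a
        using that unfolding A_def by blast
      moreover obtain x x' y y' where zz: "z = (y - y') - s * (x - x')" "x \<in> A" "x' \<in> A" "y \<in> A" "y' \<in> A"
        using z by blast
      ultimately obtain n1 r1 n2 r2 n3 r3 n4 r4 where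
        1: "y = val n1" "\<forall>i\<in>I. \<bar>of_int (n1 i) - r1 * u i\<bar> \<le> 1" and
        2: "y' = val n2" "\<forall>i\<in>I. \<bar>of_int (n2 i) - r2 * u i\<bar> \<le> 1" and
        3: "x = val n3" "\<forall>i\<in>I. \<bar>of_int (n3 i) - r3 * u i\<bar> \<le> 1" and
        4: "x' = val n4" "\<forall>i\<in>I. \<bar>of_int (n4 i) - r4 * u i\<bar> \<le> 1" by metis
      define m where "m i = n1 i - n2 i" for i
      define m' where "m' i = n3 i - n4 i" for i
      have m: "\<bar>of_int (m i) - (r1 - r2) * u i\<bar> \<le> 2" if "i \<in> I" for i
        using bspec[OF 1(2) that] bspec[OF 2(2) that] unfolding m_def by (simp add: algebra_simps abs_le_iff)
      have m': "\<bar>of_int (m' i) - (r3 - r4) * u i\<bar> \<le> 2" if "i \<in> I" for i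
        using bspec[OF 3(2) that] bspec[OF 4(2) that] unfolding m'_def by (simp add: algebra_simps abs_le_iff)
      have val_diff: "val a - val b = val (\<lambda>i. a i - b i)" for a b
        unfolding val_def by (simp add: sum_subtractf[symmetric] right_diff_distrib)
      define k where "k i = c s * m i - op s m' i" for i
      have "?c * z = ?c * val m - ?c * s * val m'"
        unfolding zz 1 2 3 4 val_diff m_def m'_def by (simp add: algebra_simps)
      also have "\<dots> = (\<Sum>i\<in>I. \<phi> i * of_int (k i))"
        unfolding k_def val_def op_left[OF s, symmetric]
        by (simp add: sum_distrib_left sum_subtractf[symmetric] algebra_simps)
      finally have "?c * z = (\<Sum>i\<in>I. \<phi> i * of_int (k i))" .
      moreover have "\<bar>of_int (k i) - (?c * (r1 - r2) - ?c * s * (r3 - r4)) * u i\<bar> \<le> B" if i: "i \<in> I" for i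
      proof -
        have "of_int (op s m' i) - ?c * s * (r3 - r4) * u i =
            (\<Sum>l<e s. of_int (M s (i s) l) * of_int (m' (i(s := l)))) - (r3 - r4) * (?c * s * u i)"
          unfolding op_def by simp
        also have "\<dots> = (\<Sum>l<e s. of_int (M s (i s) l) * (of_int (m' (i(s := l))) - (r3 - r4) * u (i(s := l))))"
          unfolding op_right[OF s i, symmetric] sum_distrib_left sum_subtractf[symmetric]
          by (intro sum.cong) (simp_all add: algebra_simps)
        also have "\<bar>\<dots>\<bar> \<le> (\<Sum>l<e s. \<bar>of_int (M s (i s) l)\<bar> * 2)"
          by (rule order_trans[OF sum_abs])
            (auto simp: abs_mult intro!: sum_mono mult_left_mono m' I_upd i s)
        also have "\<dots> = 2 * (\<Sum>l<e s. \<bar>of_int (M s (i s) l)\<bar>)" by (simp add: sum_distrib_right[symmetric])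
        also have "\<dots> \<le> 2 * (\<Sum>k<e s. \<Sum>l<e s. \<bar>real_of_int (M s k l)\<bar>)"
          using member_le_sum[of "i s" "{..<e s}" "\<lambda>k. \<Sum>l<e s. \<bar>real_of_int (M s k l)\<bar>"] I_less[OF i s]
          by (simp add: sum_nonneg)
        finally have *: "\<bar>of_int (op s m' i) - ?c * s * (r3 - r4) * u i\<bar>
          \<le> 2 * (\<Sum>k<e s. \<Sum>l<e s. \<bar>real_of_int (M s k l)\<bar>)" .
        have "\<bar>?c * (of_int (m i) - (r1 - r2) * u i)\<bar> \<le> \<bar>?c\<bar> * 2"
          unfolding abs_mult by (intro mult_left_mono m i) simp
        moreover have "of_int (k i) - (?c * (r1 - r2) - ?c * s * (r3 - r4)) * u i =
          ?c * (of_int (m i) - (r1 - r2) * u i) - (of_int (op s m' i) - ?c * s * (r3 - r4) * u i)"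
          unfolding k_def by (simp add: algebra_simps)
        ultimately show ?thesis using * unfolding B_def by linarith
      qed
      ultimately show ?thesis unfolding Z_def by blast
    qed
    have "finite (?G \<inter> {-N..N}) \<and> real (card (?G \<inter> {-N..N})) \<le> (C * \<bar>?c\<bar>) * N" if N: "N \<ge> 1" for N
    proof -
      have N': "1 \<le> \<bar>?c\<bar> * N" using mult_mono[OF c1 N] by simp
      have inj: "inj_on ((*) ?c) (?G \<inter> {-N..N})" using c0[OF s] by (intro inj_onI) simp
      have sub: "(*) ?c ` (?G \<inter> {-N..N}) \<subseteq> Z \<inter> {- (\<bar>?c\<bar> * N)..\<bar>?c\<bar> * N}"
      proof
        fix z' assume "z' \<in> (*) ?c ` (?G \<inter> {-N..N})"
        then obtain z where z: "z \<in> ?G" "z \<in> {-N..N}" "z' = ?c * z" by blast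
        have "\<bar>?c * z\<bar> \<le> \<bar>?c\<bar> * N" unfolding abs_mult using z(2) by (intro mult_left_mono) auto
        then show "z' \<in> Z \<inter> {- (\<bar>?c\<bar> * N)..\<bar>?c\<bar> * N}" using cG[OF z(1)] z(3) by (auto simp: abs_le_iff)
      qed
      have fin: "finite (Z \<inter> {- (\<bar>?c\<bar> * N)..\<bar>?c\<bar> * N})" using C(2)[OF N'] by blast
      have "finite (?G \<inter> {-N..N})" using inj_on_finite[OF inj sub fin] .
      moreover have "real (card (?G \<inter> {-N..N})) \<le> real (card (Z \<inter> {- (\<bar>?c\<bar> * N)..\<bar>?c\<bar> * N}))"
        using card_inj_on_le[OF inj sub fin] by simp
      moreover have "\<dots> \<le> C * (\<bar>?c\<bar> * N)" using C(2)[OF N'] by blast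
      ultimately show ?thesis by (simp add: mult.assoc)
    qed
    then show "\<exists>C\<ge>0. \<forall>N\<ge>1. finite (?G \<inter> {-N..N}) \<and> real (card (?G \<inter> {-N..N})) \<le> C * N"
      using C(1) by (intro exI[of _ "C * \<bar>?c\<bar>"]) simp
  qed
qed

section \<open>Polygonal norms and the main theorem\<close>

context normed_plane
begin

text \<open>Pushing a unit vector outwards leaves the ball, so it lies on the boundary, which is the
  union of the facets; in dimension 2 these are the edges.\<close>

lemma unit_vector_on_edge:
  assumes poly: "convex_polygon (unit_ball nrm)" and x: "nrm x = 1"
  shows "\<exists>I. I edge_of unit_ball nrm \<and> x \<in> I"
proof -
  have "polyhedron (unit_ball nrm)"
    using poly unfolding convex_polygon_def by (simp add: polytope_imp_polyhedron)
  then have bd: "unit_ball nrm - rel_interior (unit_ball nrm) = \<Union> {F. F facet_of unit_ball nrm}"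
    by (rule rel_boundary_of_polyhedron)
  have "x \<notin> interior (unit_ball nrm)"
  proof
    assume "x \<in> interior (unit_ball nrm)"
    then obtain \<delta> where \<delta>: "\<delta> > 0" "ball x \<delta> \<subseteq> unit_ball nrm" by (meson mem_interior)
    define r where "r = \<delta> / (2 * (norm x + 1))"
    have n1: "norm x + 1 > 0" using norm_ge_zero[of x] by linarith
    have r: "r > 0" unfolding r_def using \<delta>(1) n1 by simp
    have "r * norm x < \<delta>"
    proof -
      have "r * norm x \<le> r * (norm x + 1)" using r by simp
      also have "\<dots> = \<delta> / 2" unfolding r_def using n1 by (simp add: divide_simps)
      finally show ?thesis using \<delta>(1) by simp
    qed
    then have "x + r *\<^sub>R x \<in> ball x \<delta>" using r by (simp add: dist_norm)
    then have "nrm ((1 + r) *\<^sub>R x) \<le> 1" using \<delta>(2) unfolding unit_ball_def by (auto simp: algebra_simps)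
    then show False using r x by simp
  qed
  moreover have "rel_interior (unit_ball nrm) = interior (unit_ball nrm)"
    using interior_rel_interior[of "unit_ball nrm"] aff_dim_unit_ball by simp
  moreover have "x \<in> unit_ball nrm" using x unfolding unit_ball_def by simp
  ultimately obtain F where F: "F facet_of unit_ball nrm" "x \<in> F" using bd by blast
  then have "F edge_of unit_ball nrm"
    unfolding facet_of_def edge_of_def aff_dim_unit_ball by simp
  with F show ?thesis by blast
qed

lemma finite_edges:
  assumes "convex_polygon (unit_ball nrm)"
  shows "finite {I. I edge_of unit_ball nrm}"
  using assms finite_polytope_faces[of "unit_ball nrm"] unfolding convex_polygon_def edge_of_def
  by (auto elim: rev_finite_subset)

lemma polygon_norm_eq:
  assumes poly: "convex_polygon (unit_ball nrm)"
    and v: "\<And>I x. I edge_of unit_ball nrm \<Longrightarrow> x \<in> I \<Longrightarrow> det2 (v I) x = 1" and x: "x \<noteq> 0"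
  shows "\<exists>I. I edge_of unit_ball nrm \<and> nrm x = det2 (v I) x"
proof -
  have pos: "nrm x > 0" using x nrm_ge_0[of x] by (simp add: less_le)
  then have "nrm ((1 / nrm x) *\<^sub>R x) = 1" using x by simp
  then obtain I where I: "I edge_of unit_ball nrm" "(1 / nrm x) *\<^sub>R x \<in> I"
    using unit_vector_on_edge[OF poly] by blast
  have "1 / nrm x * det2 (v I) x = 1" using v[OF I] unfolding det2_algebra .
  then show ?thesis using I(1) x by (auto simp: field_simps)
qed

text \<open>On differences of \<open>S\<close> the functional of a side with slope s is a constant
  times (y - y') - s (x - x'), and every non-zero distance is a value of one of these finitely many
  functionals.\<close>

lemma exists_sparse_set:
  assumes poly: "convex_polygon (unit_ball nrm)" and cs: "coordinate_system e1 e2"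
    and slopes: "\<And>I. I edge_of unit_ball nrm \<Longrightarrow> algebraic_slope (slope e1 e2 I)"
  obtains S C where "well_distributed nrm S"
    "\<And>N. N \<ge> 1 \<Longrightarrow> finite (distance_set nrm N S) \<and> real (card (distance_set nrm N S)) \<le> C * real N"
proof -
  define E where "E = {I. I edge_of unit_ball nrm}"
  have finE: "finite E" unfolding E_def by (rule finite_edges[OF poly])
  have "\<exists>v p q. (\<forall>x\<in>I. det2 v x = 1) \<and> p \<in> I \<and> q \<in> I \<and> p \<noteq> q" if "I \<in> E" for I
  proof -
    have "I edge_of unit_ball nrm" using that unfolding E_def by simp
    then show ?thesis by (rule edge_functional[OF poly]) blast
  qed
  then obtain v p q where v: "\<And>I x. I \<in> E \<Longrightarrow> x \<in> I \<Longrightarrow> det2 (v I) x = 1"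
    and pq: "\<And>I. I \<in> E \<Longrightarrow> p I \<in> I" "\<And>I. I \<in> E \<Longrightarrow> q I \<in> I" "\<And>I. I \<in> E \<Longrightarrow> p I \<noteq> q I" by metis
  have d: "det2 e1 e2 \<noteq> 0" using cs coordinate_system_iff_det2 by blast
  have rep: "\<exists>x1 x2. x = x1 *\<^sub>R e1 + x2 *\<^sub>R e2" for x
    using det2_coordinates[OF d] by blast
  \<comment> \<open>A side of infinite slope sees only the first coordinate; it is treated as slope
    0 with the coordinates exchanged.\<close>
  define sl where "sl I = (if det2 (v I) e2 = 0 then 0 else - det2 (v I) e1 / det2 (v I) e2)" for I
  define \<kappa> where "\<kappa> I = (if det2 (v I) e2 = 0 then det2 (v I) e1 else det2 (v I) e2)" for I
  have alg: "algebraic (sl I)" if I: "I \<in> E" for I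
  proof -
    have "slope e1 e2 I = (if det2 (v I) e2 = 0 then \<infinity> else ereal (- det2 (v I) e1 / det2 (v I) e2))"
      by (rule slope_edge[OF cs pq[OF I] v[OF I]])
    then show ?thesis
      using slopes[of I] I unfolding E_def sl_def algebraic_slope_def by (auto split: if_splits)
  qed
  have \<kappa>0: "\<kappa> I \<noteq> 0" if I: "I \<in> E" for I
  proof
    assume "\<kappa> I = 0"
    then have z: "det2 (v I) e1 = 0" "det2 (v I) e2 = 0" unfolding \<kappa>_def by (auto split: if_splits)
    obtain x1 x2 where "p I = x1 *\<^sub>R e1 + x2 *\<^sub>R e2" using rep by blast
    then have "det2 (v I) (p I) = 0" by (simp add: det2_algebra z)
    then show False using v[OF I pq(1)[OF I]] by simp
  qed
  obtain A M where A: "\<And>x::real. \<exists>a\<in>A. \<bar>x - a\<bar> \<le> M"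
    and G: "\<And>s. s \<in> sl ` E \<Longrightarrow> \<exists>C\<ge>0. \<forall>N\<ge>1.
       finite ({(y - y') - s * (x - x') | x x' y y'. {x, x', y, y'} \<subseteq> A} \<inter> {-N..N}) \<and>
       real (card ({(y - y') - s * (x - x') | x x' y y'. {x, x', y, y'} \<subseteq> A} \<inter> {-N..N})) \<le> C * N"
    by (rule algebraic_numbers_lattice[of "sl ` E"]) (use finE alg in auto)
  define S where "S = {a *\<^sub>R e1 + b *\<^sub>R e2 | a b. a \<in> A \<and> b \<in> A}"
  define H where "H I = det2 (v I) ` differences S" for I
  have "\<exists>C\<ge>0. \<forall>N\<ge>1. finite (H I \<inter> {-N..N}) \<and> real (card (H I \<inter> {-N..N})) \<le> C * N" if I: "I \<in> E" for I
  proof -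
    let ?G = "{(y - y') - sl I * (x - x') | x x' y y'. {x, x', y, y'} \<subseteq> A}"
    obtain C where C: "C \<ge> 0"
      "\<And>N. N \<ge> 1 \<Longrightarrow> finite (?G \<inter> {-N..N}) \<and> real (card (?G \<inter> {-N..N})) \<le> C * N"
      using G[of "sl I"] I by blast
    \<comment> \<open>The second summand pays for division by \<kappa>, the first keeps
      \<open>r * N\<close> at least 1.\<close>
    define r where "r = 1 + 1 / \<bar>\<kappa> I\<bar>"
    have r: "r \<ge> 1" unfolding r_def by simp
    have HG: "\<exists>g\<in>?G. h = \<kappa> I * g" if "h \<in> H I" for h
    proof -
      obtain x y x' y' where A: "x \<in> A" "y \<in> A" "x' \<in> A" "y' \<in> A"
        and h: "h = det2 (v I) ((x *\<^sub>R e1 + y *\<^sub>R e2) - (x' *\<^sub>R e1 + y' *\<^sub>R e2))"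
        using \<open>h \<in> H I\<close> unfolding H_def differences_def S_def by blast
      have h': "h = (x - x') * det2 (v I) e1 + (y - y') * det2 (v I) e2"
        unfolding h det2_algebra by (simp add: algebra_simps)
      show ?thesis
      proof (cases "det2 (v I) e2 = 0")
        case True
        then have "h = \<kappa> I * ((x - x') - sl I * (y - y'))" unfolding h' \<kappa>_def sl_def by simp
        then show ?thesis using A by blast
      next
        case False
        then have "h = \<kappa> I * ((y - y') - sl I * (x - x'))" unfolding h' \<kappa>_def sl_def by (simp add: field_simps)
        then show ?thesis using A by blast
      qed
    qed
    have "finite (H I \<inter> {-N..N}) \<and> real (card (H I \<inter> {-N..N})) \<le> (C * r) * N" if N: "N \<ge> 1" for N
    proof -
      have rN: "1 \<le> r * N" using mult_mono[OF r N] r by simp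
      have sub: "H I \<inter> {-N..N} \<subseteq> (*) (\<kappa> I) ` (?G \<inter> {- (r * N)..r * N})"
      proof
        fix h assume h: "h \<in> H I \<inter> {-N..N}"
        then obtain g where g: "g \<in> ?G" "h = \<kappa> I * g" using HG by blast
        have "\<bar>g\<bar> = \<bar>h\<bar> / \<bar>\<kappa> I\<bar>" using g(2) \<kappa>0[OF I] by (simp add: abs_mult)
        also have "\<dots> \<le> N / \<bar>\<kappa> I\<bar>" using h by (intro divide_right_mono) auto
        also have "\<dots> \<le> r * N" unfolding r_def using N by (simp add: algebra_simps)
        finally have "g \<in> {- (r * N)..r * N}" by (simp add: abs_le_iff)
        then show "h \<in> (*) (\<kappa> I) ` (?G \<inter> {- (r * N)..r * N})"
          unfolding g(2) using g(1) by (intro imageI IntI)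
      qed
      have fin: "finite (?G \<inter> {- (r * N)..r * N})" using C(2)[OF rN] by blast
      have "finite (H I \<inter> {-N..N})" using sub fin finite_subset by blast
      moreover have "card (H I \<inter> {-N..N}) \<le> card (?G \<inter> {- (r * N)..r * N})"
        using fin sub by (rule surj_card_le)
      moreover have "real (card (?G \<inter> {- (r * N)..r * N})) \<le> C * (r * N)" using C(2)[OF rN] by blast
      ultimately show ?thesis by (simp add: mult.assoc)
    qed
    then show ?thesis using C(1) r by (intro exI[of _ "C * r"]) simp
  qed
  then obtain C where C: "\<And>I N. I \<in> E \<Longrightarrow> N \<ge> 1 \<Longrightarrow>
    finite (H I \<inter> {-N..N}) \<and> real (card (H I \<inter> {-N..N})) \<le> C I * N" by metis
  show ?thesis
  \<comment> \<open>The 1 accounts for the distance 0, which \<open>polygon_norm_eq\<close> leaves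
    out.\<close>
  proof (rule that[of S "1 + (\<Sum>I\<in>E. C I)"])
    show "well_distributed nrm S"
      unfolding well_distributed_def
    proof (intro exI allI)
      fix x
      obtain x1 x2 where x: "x = x1 *\<^sub>R e1 + x2 *\<^sub>R e2" using rep by blast
      obtain a where a: "a \<in> A" "\<bar>x1 - a\<bar> \<le> M" using A by blast
      obtain b where b: "b \<in> A" "\<bar>x2 - b\<bar> \<le> M" using A by blast
      have "x - (a *\<^sub>R e1 + b *\<^sub>R e2) = (x1 - a) *\<^sub>R e1 + (x2 - b) *\<^sub>R e2"
        unfolding x by (simp add: algebra_simps)
      also have "nrm \<dots> \<le> \<bar>x1 - a\<bar> * nrm e1 + \<bar>x2 - b\<bar> * nrm e2"
        using nrm_triangle[of "(x1 - a) *\<^sub>R e1" "(x2 - b) *\<^sub>R e2"] by simp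
      also have "\<dots> \<le> M * nrm e1 + M * nrm e2" using a b by (intro add_mono mult_right_mono) auto
      finally show "\<exists>y\<in>S. nrm (x - y) \<le> M * nrm e1 + M * nrm e2" using a b unfolding S_def by blast
    qed
    fix N :: nat assume N: "N \<ge> 1"
    let ?U = "\<Union>I\<in>E. H I \<inter> {-real N..real N}"
    have sub: "distance_set nrm N S \<subseteq> insert 0 ?U"
    proof
      fix t assume "t \<in> distance_set nrm N S"
      then obtain a b where ab: "a \<in> S" "b \<in> S" "t = nrm (a - b)" "t \<le> real N"
        unfolding distance_set_def by blast
      show "t \<in> insert 0 ?U"
      proof (cases "a - b = 0")
        case False
        have "\<exists>I. I edge_of unit_ball nrm \<and> nrm (a - b) = det2 (v I) (a - b)"
          by (rule polygon_norm_eq[OF poly _ False]) (use v in \<open>auto simp: E_def\<close>)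
        then obtain I where I: "I \<in> E" "t = det2 (v I) (a - b)" unfolding E_def using ab(3) by blast
        have "a - b \<in> differences S" unfolding differences_def using ab by blast
        then have "t \<in> H I" unfolding H_def I(2) by blast
        moreover have "t \<ge> 0" using ab(3) by simp
        ultimately show ?thesis using I(1) ab(4) by auto
      qed (use ab(3) in simp)
    qed
    have fin: "finite ?U" by (rule finite_UN_I[OF finE]) (use C N in auto)
    have "card (distance_set nrm N S) \<le> card (insert 0 ?U)" using fin sub by (intro card_mono) auto
    also have "\<dots> \<le> 1 + card ?U" using card_insert_le_m1[of "1 + card ?U" ?U 0] by simp
    also have "\<dots> \<le> 1 + (\<Sum>I\<in>E. card (H I \<inter> {-real N..real N}))" by (intro add_left_mono card_UN_le finE)
    finally have "real (card (distance_set nrm N S)) \<le> real (1 + (\<Sum>I\<in>E. card (H I \<inter> {-real N..real N})))"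
      by (rule of_nat_mono)
    also have "\<dots> = 1 + (\<Sum>I\<in>E. real (card (H I \<inter> {-real N..real N})))" by simp
    also have "\<dots> \<le> real N + (\<Sum>I\<in>E. C I * real N)"
      using C N by (intro add_mono sum_mono) auto
    also have "\<dots> = (1 + (\<Sum>I\<in>E. C I)) * real N" by (simp add: sum_distrib_right distrib_right)
    finally show "finite (distance_set nrm N S) \<and>
        real (card (distance_set nrm N S)) \<le> (1 + (\<Sum>I\<in>E. C I)) * real N"
      using finite_subset[OF sub] fin by simp
  qed
qed

end

text \<open>Finiteness is stated separately because \<open>card\<close> of an infinite set is 0: the
  bound alone would hold for the whole plane.\<close>

theorem theorem3:
  fixes nrm :: "real ^ 2 \<Rightarrow> real"
  assumes "is_norm nrm"
  shows
    "(convex_polygon (unit_ball nrm) \<and>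
      (\<exists>e1 e2. coordinate_system e1 e2 \<and>
        (\<forall>I. I edge_of unit_ball nrm \<longrightarrow> algebraic_slope (slope e1 e2 I))))
     \<longleftrightarrow>
     (\<exists>S. well_distributed nrm S \<and>
        (\<forall>\<^sub>F N in sequentially. finite (distance_set nrm N S)) \<and>
        (\<lambda>N. real (card (distance_set nrm N S))) \<in> O(\<lambda>N. real N))"
    (is "?polygon \<longleftrightarrow> ?sparse")
proof
  interpret normed_plane nrm by unfold_locales fact
  assume ?polygon
  then obtain e1 e2 where poly: "convex_polygon (unit_ball nrm)" and cs: "coordinate_system e1 e2"
    and slopes: "\<And>I. I edge_of unit_ball nrm \<Longrightarrow> algebraic_slope (slope e1 e2 I)" by blast
  obtain S C where S: "well_distributed nrm S"
    and C: "\<And>N. N \<ge> 1 \<Longrightarrow> finite (distance_set nrm N S) \<and> real (card (distance_set nrm N S)) \<le> C * real N"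
    using exists_sparse_set[OF poly cs slopes] by blast
  have "(\<lambda>N. real (card (distance_set nrm N S))) \<in> O(\<lambda>N. real N)"
    by (rule bigoI[of _ C], rule eventually_sequentiallyI[of 1]) (use C in auto)
  moreover have "\<forall>\<^sub>F N in sequentially. finite (distance_set nrm N S)"
    by (rule eventually_sequentiallyI[of 1]) (use C in auto)
  ultimately show ?sparse using S by blast
next
  assume ?sparse
  then obtain S where S: "well_distributed nrm S" "\<forall>\<^sub>F N in sequentially. finite (distance_set nrm N S)"
    "(\<lambda>N. real (card (distance_set nrm N S))) \<in> O(\<lambda>N. real N)" by blast
  obtain K where K: "\<And>x. \<exists>y\<in>S. nrm (x - y) \<le> K" using S(1) unfolding well_distributed_def by blast
  obtain C where "\<forall>\<^sub>F N in sequentially. norm (real (card (distance_set nrm N S))) \<le> C * norm (real N)"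
    using S(3) by (elim landau_o.bigE)
  with S(2) have "\<forall>\<^sub>F N in sequentially. finite (distance_set nrm N S) \<and>
      real (card (distance_set nrm N S)) \<le> C * real N"
    by eventually_elim simp
  then obtain N0 where N0: "\<And>N. N \<ge> N0 \<Longrightarrow> finite (distance_set nrm N S) \<and>
      real (card (distance_set nrm N S)) \<le> C * real N"
    unfolding eventually_sequentially by blast
  interpret sparse_distances nrm S K C N0
    by unfold_locales (use assms K N0 in auto)
  show ?polygon using polygon algebraic_slopes by blast
qed

end
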